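(* Let $\mathcal X\subset\mathbb R^n$ be Lebesgue measurable and let $g,h_1,\dots,h_k$ be real-valued functions that are $C^\infty$ on an open neighborhood of $\mathcal X\times\mathbb R^m$. Assume there is a constant $\rho>0$ such that for every $x\in\mathcal X$ there is a point $y$ in the interior of $\mathcal Y(x)=\{y\in\mathbb R^m: h_i(x,y)\le0,\ i=1,\dots,k\}$ with $h_i(x,y)\le-\rho$ for all $i=1,\dots,k$. Fix any constant $0<\nu<\rho$, draw $b=(b_1,\dots,b_m)$ uniformly from $[0,\nu]^m$ and $a=(a_1,\dots,a_k)$ uniformly from $[0,\nu]^k$, and set $$\widetilde g(x,y)=g(x,y)+\langle y,b\rangle,\qquad \widetilde h_i(x,y)=h_i(x,y)+a_i\quad\text{for all }i.$$ Then, with probability one with respect to the random choice of $(b,a)$, the set of $x\in\mathcal X$ at which the second-order sufficient conditions (SOSC) do not hold at some local minimizer $y$ of the perturbed problem $\min_y\widetilde g(x,y)$ s.t. $\widetilde h_i(x,y)\le0$, $i=1,\dots,k$, has Lebesgue measure zero.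
   Context: KKT pair of the perturbed problem at $x$: $(y,\lambda)\in\mathbb R^m\times\mathbb R^k$ with $\nabla_y\widetilde g(x,y)+\sum_i\lambda_i\nabla_y\widetilde h_i(x,y)=0$, $\widetilde h_i(x,y)\le0$, $\lambda_i\ge0$, $\lambda_i\widetilde h_i(x,y)=0$ for all $i$. Lagrangian: $\widetilde{\mathcal L}(x,y,\lambda)=\widetilde g(x,y)+\sum_i\lambda_i\widetilde h_i(x,y)$. SOSC holds at a KKT pair $(y^\ast,\lambda^\ast)$ at $x$ if $d^\top\nabla^2_{yy}\widetilde{\mathcal L}(x,y^\ast,\lambda^\ast)d>0$ for all nonzero $d\in\mathcal C(x,y^\ast)$, where $\mathcal C(x,y^\ast)=\{d\in\mathbb R^m:$ for all $i$ with $\widetilde h_i(x,y^\ast)=0$, $\nabla_y\widetilde h_i(x,y^\ast)^\top d=0$ if $\lambda^\ast_i>0$ and $\nabla_y\widetilde h_i(x,y^\ast)^\top d\le0$ if $\lambda^\ast_i=0\}$. SOSC holds at a local minimizer $y$ if $y$ admits a KKT multiplier and SOSC holds at $(y,\lambda)$ for every associated KKT multiplier $\lambda$. The random vectors $a$ and $b$ are independent. *)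

theory Defs
  imports "HOL-Probability.Probability"
begin

section \<open>Smooth functions on open sets\<close>

text \<open>For an open set \<open>U\<close>: all iterated directional derivatives up to order \<open>n\<close> exist and are
  continuous on \<open>U\<close>, the derivatives of order below \<open>n\<close> being totally differentiable.\<close>

primrec Ck_on :: "nat \<Rightarrow> ('a::euclidean_space \<Rightarrow> real) \<Rightarrow> 'a set \<Rightarrow> bool" where
  "Ck_on 0 f U \<longleftrightarrow> continuous_on U f"
| "Ck_on (Suc n) f U \<longleftrightarrow>
     (\<forall>x\<in>U. f differentiable (at x)) \<and> (\<forall>v. Ck_on n (\<lambda>x. frechet_derivative f (at x) v) U)"

definition C_infinity_on :: "('a::euclidean_space \<Rightarrow> real) \<Rightarrow> 'a set \<Rightarrow> bool" where
  "C_infinity_on f U \<longleftrightarrow> (\<forall>n. Ck_on n f U)"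

definition gradient :: "('a::euclidean_space \<Rightarrow> real) \<Rightarrow> 'a \<Rightarrow> 'a" where
  "gradient f y = (THE D. GDERIV f y :> D)"

definition hessian :: "(real^'m \<Rightarrow> real) \<Rightarrow> real^'m \<Rightarrow> real^'m^'m" where
  "hessian f y = jacobian (gradient f) (at y)"

section \<open>Parametric constrained minimization\<close>

text \<open>The problem at the parameter \<open>x\<close> is to minimize \<open>G (x, y)\<close> over \<open>y\<close> subject to
  \<open>H i (x, y) \<le> 0\<close> for all \<open>i\<close>. All derivatives below are taken in \<open>y\<close> only.\<close>

definition feasible_set :: "('k \<Rightarrow> 'x \<times> 'y \<Rightarrow> real) \<Rightarrow> 'x \<Rightarrow> 'y set" where
  "feasible_set H x = {y. \<forall>i. H i (x, y) \<le> 0}"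

definition local_minimizer ::
  "('x \<times> 'y::metric_space \<Rightarrow> real) \<Rightarrow> ('k \<Rightarrow> 'x \<times> 'y \<Rightarrow> real) \<Rightarrow> 'x \<Rightarrow> 'y \<Rightarrow> bool" where
  "local_minimizer G H x y \<longleftrightarrow> y \<in> feasible_set H x \<and>
     (\<exists>e>0. \<forall>z \<in> feasible_set H x \<inter> ball y e. G (x, y) \<le> G (x, z))"

definition lagrangian ::
  "('x \<times> 'y \<Rightarrow> real) \<Rightarrow> ('k::finite \<Rightarrow> 'x \<times> 'y \<Rightarrow> real) \<Rightarrow> 'x \<Rightarrow> 'y \<Rightarrow> real^'k \<Rightarrow> real" where
  "lagrangian G H x y l = G (x, y) + (\<Sum>i\<in>UNIV. l $ i * H i (x, y))"

definition kkt_pair ::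
  "('x \<times> (real^'m) \<Rightarrow> real) \<Rightarrow> ('k::finite \<Rightarrow> 'x \<times> (real^'m) \<Rightarrow> real) \<Rightarrow>
   'x \<Rightarrow> real^'m \<Rightarrow> real^'k \<Rightarrow> bool" where
  "kkt_pair G H x y l \<longleftrightarrow>
     gradient (\<lambda>z. G (x, z)) y + (\<Sum>i\<in>UNIV. l $ i *\<^sub>R gradient (\<lambda>z. H i (x, z)) y) = 0 \<and>
     (\<forall>i. H i (x, y) \<le> 0 \<and> l $ i \<ge> 0 \<and> l $ i * H i (x, y) = 0)"

definition critical_cone ::
  "('k::finite \<Rightarrow> 'x \<times> (real^'m) \<Rightarrow> real) \<Rightarrow> 'x \<Rightarrow> real^'m \<Rightarrow> real^'k \<Rightarrow> (real^'m) set" where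
  "critical_cone H x y l =
     {d. \<forall>i. H i (x, y) = 0 \<longrightarrow>
           (l $ i > 0 \<longrightarrow> gradient (\<lambda>z. H i (x, z)) y \<bullet> d = 0) \<and>
           (l $ i = 0 \<longrightarrow> gradient (\<lambda>z. H i (x, z)) y \<bullet> d \<le> 0)}"

definition sosc_at_pair ::
  "('x \<times> (real^'m) \<Rightarrow> real) \<Rightarrow> ('k::finite \<Rightarrow> 'x \<times> (real^'m) \<Rightarrow> real) \<Rightarrow>
   'x \<Rightarrow> real^'m \<Rightarrow> real^'k \<Rightarrow> bool" where
  "sosc_at_pair G H x y l \<longleftrightarrow>
     (\<forall>d \<in> critical_cone H x y l. d \<noteq> 0 \<longrightarrow>
        d \<bullet> (hessian (\<lambda>z. lagrangian G H x z l) y *v d) > 0)"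

definition sosc_at ::
  "('x \<times> (real^'m) \<Rightarrow> real) \<Rightarrow> ('k::finite \<Rightarrow> 'x \<times> (real^'m) \<Rightarrow> real) \<Rightarrow>
   'x \<Rightarrow> real^'m \<Rightarrow> bool" where
  "sosc_at G H x y \<longleftrightarrow>
     (\<exists>l. kkt_pair G H x y l) \<and> (\<forall>l. kkt_pair G H x y l \<longrightarrow> sosc_at_pair G H x y l)"

section \<open>Random linear perturbation\<close>

definition perturbed_objective ::
  "('x \<times> (real^'m) \<Rightarrow> real) \<Rightarrow> real^'m \<Rightarrow> 'x \<times> (real^'m) \<Rightarrow> real" where
  "perturbed_objective g b = (\<lambda>(x, y). g (x, y) + y \<bullet> b)"

definition perturbed_constraint ::
  "('k::finite \<Rightarrow> 'x \<times> 'y \<Rightarrow> real) \<Rightarrow> real^'k \<Rightarrow> 'k \<Rightarrow> 'x \<times> 'y \<Rightarrow> real" where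
  "perturbed_constraint h a = (\<lambda>i (x, y). h i (x, y) + a $ i)"

definition uniform_cube :: "real \<Rightarrow> (real^'d) measure" where
  "uniform_cube \<nu> = uniform_measure lborel (cbox 0 (\<chi> i. \<nu>))"

end

theory Submission
  imports Defs
begin

text \<open>
  Sard's theorem is only needed for maps between spaces of the same dimension, because the
  multipliers join the unknowns and \<open>b\<close> joins the values: for an active set \<open>I\<close>, the KKT system
  solved for the data is the map \<open>(x, y, \<mu>) \<mapsto> ((b, a), x)\<close> with
  \<open>b = - \<nabla>g - \<Sum>\<^sub>I \<mu>\<^sub>i \<nabla>h\<^sub>i\<close>, \<open>a\<^sub>i = - h\<^sub>i\<close> on \<open>I\<close> and \<open>a\<^sub>i = \<mu>\<^sub>i\<close> off \<open>I\<close>. At a regular point its derivative, the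
  bordered Hessian, is onto. This gives linear independence of the active gradients, and it turns
  the second-order necessary condition on their common kernel into the sufficient one. The image of
  \<open>{\<mu>\<^sub>i = 0}\<close> is null, so complementarity is strict and that kernel is the critical cone.

  That local minimizers have multipliers at all would be the place for the general Sard theorem.
  It is replaced by calmness: the minimum over a compact ball, as a function of \<open>t\<close> along
  \<open>a + t (1, \<dots>, 1)\<close>, is monotone, hence for almost every \<open>a\<close> it decreases at most linearly when the
  constraints are relaxed. A minimizer is then an unconstrained minimizer of an exact penalty
  function, which yields the multipliers. Testing the penalty function along parabolas gives the
  second-order necessary condition without an implicit function theorem. All exceptional
  sets are null in the joint space of \<open>((b, a), x)\<close>, and Fubini's theorem concludes.
\<close>

section \<open>Monotone functions have finite slopes almost everywhere\<close>

text \<open>Disjointness orders the intervals, so the increments telescope: all intervals except the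
  rightmost one \<open>{b - s b..b}\<close> end at or before \<open>b - s b\<close>, and the
  induction hypothesis is applied with this point as the new bound \<open>u\<close>.\<close>

lemma mono_disjoint_increments_le:
  fixes f s :: "real \<Rightarrow> real"
  assumes "mono f" and A: "\<And>t. A \<le> f t" and "finite F"
    and "\<And>t. t \<in> F \<Longrightarrow> 0 < s t"
    and "pairwise (\<lambda>t u. disjnt {t - s t..t} {u - s u..u}) F"
    and "\<And>t. t \<in> F \<Longrightarrow> t \<le> u"
  shows "(\<Sum>t\<in>F. f t - f (t - s t)) \<le> f u - A"
  using assms(3-)
proof (induction F arbitrary: u rule: finite_linorder_max_induct)
  case empty
  then show ?case using A by simp
next
  case (insert b F)
  have "t \<le> b - s b" if "t \<in> F" for t
  proof (rule ccontr)
    assume "\<not> t \<le> b - s b"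
    moreover have "t < b" "0 < s t" using insert that by auto
    ultimately have "t \<in> {t - s t..t}" "t \<in> {b - s b..b}" by auto
    moreover have "disjnt {t - s t..t} {b - s b..b}"
      using insert.prems(2) that \<open>t < b\<close> by (auto simp: pairwise_def)
    ultimately show False by (auto simp: disjnt_iff)
  qed
  then have "(\<Sum>t\<in>F. f t - f (t - s t)) \<le> f (b - s b) - A"
    using insert by (intro insert.IH) (auto simp: pairwise_insert)
  moreover have "f b \<le> f u" using insert.prems \<open>mono f\<close> by (auto simp: mono_def)
  moreover have "b \<notin> F" using insert.hyps by auto
  ultimately show ?case using insert.hyps(1) by simp
qed

text \<open>Vitali covering: each bad point is the right end of an interval on which
  \<open>f\<close> has mean slope at least \<open>M\<close>. Disjoint intervals of this kind have
  total length at most \<open>(B - A) / M\<close>, their fivefold enlargements cover the bad set,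
  and \<open>M\<close> is arbitrary.\<close>

lemma negligible_mono_infinite_left_slope:
  fixes f :: "real \<Rightarrow> real"
  assumes "mono f" and A: "\<And>t. A \<le> f t" and B: "\<And>t. f t \<le> B"
  shows "negligible {t. \<forall>M::nat. \<exists>s>0. real M * s \<le> f t - f (t - s)}" (is "negligible ?N")
proof (clarsimp simp only: negligible_outer_le)
  fix e :: real assume "e > 0"
  \<comment> \<open>\<open>D\<close> bounds every increment of \<open>f\<close>; the 1 keeps it
    positive when \<open>A = B\<close>. The 5 in the choice of \<open>M\<close> below is the Vitali
    enlargement factor.\<close>
  define D where "D = max 1 (B - A)"
  have D: "f t - f u \<le> D" "D > 0" for t u
    using A[of u] B[of t] by (auto simp: D_def)
  obtain M :: nat where M: "5 * D / e < real M" using reals_Archimedean2 by blast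
  then have "0 < real M" using D \<open>e > 0\<close> by (smt (verit) divide_pos_pos)
  have "\<forall>t\<in>?N. \<exists>s. 0 < s \<and> real M * s \<le> f t - f (t - s)" by blast
  from bchoice[OF this] obtain s
    where s: "\<And>t. t \<in> ?N \<Longrightarrow> 0 < s t \<and> real M * s t \<le> f t - f (t - s t)"
    by blast
  have sb: "s t \<le> D / real M" if "t \<in> ?N" for t
    using s[OF that] D(1)[of t "t - s t"] \<open>0 < real M\<close> by (simp add: field_simps)
  define a r where "a t = t - s t / 2" and "r t = s t / 2" for t
  have cb: "cball (a t) (r t) = {t - s t..t}" for t
    by (auto simp: a_def r_def cball_eq_atLeastAtMost field_simps)
  obtain C where C: "countable C" "C \<subseteq> ?N"
     "pairwise (\<lambda>i j. disjnt (cball (a i) (r i)) (cball (a j) (r j))) C"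
     "?N \<subseteq> (\<Union>i\<in>C. cball (a i) (5 * r i))"
  proof (rule Vitali_covering_lemma_cballs[where S="?N" and K="?N" and a=a and r=r and B="D / real M"])
    show "?N \<subseteq> (\<Union>i\<in>?N. cball (a i) (r i))"
      unfolding cb using s by force
    show "0 < r t \<and> r t \<le> D / real M" if "t \<in> ?N" for t
      using s[OF that] order_trans[of "s t / 2" "s t", OF _ sb[OF that]] by (simp add: r_def)
  qed blast
  have bound: "measure lebesgue (\<Union>i\<in>F. cball (a i) (5 * r i)) \<le> e" if "F \<subseteq> C" "finite F" for F
  proof -
    have FN: "t \<in> ?N" if "t \<in> F" for t using that \<open>F \<subseteq> C\<close> C(2) by blast
    have "measure lebesgue (\<Union>i\<in>F. cball (a i) (5 * r i)) \<le> (\<Sum>i\<in>F. measure lebesgue (cball (a i) (5 * r i)))"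
      by (intro measure_UNION_le \<open>finite F\<close>) auto
    also have "\<dots> = (\<Sum>i\<in>F. 5 * s i)"
    proof (rule sum.cong[OF refl])
      fix i assume "i \<in> F"
      then have "s i > 0" using s[OF FN] by blast
      then show "measure lebesgue (cball (a i) (5 * r i)) = 5 * s i"
        by (simp add: cball_eq_atLeastAtMost r_def)
    qed
    also have "\<dots> \<le> (\<Sum>i\<in>F. 5 / real M * (f i - f (i - s i)))"
    proof (rule sum_mono)
      fix i assume "i \<in> F"
      show "5 * s i \<le> 5 / real M * (f i - f (i - s i))"
        using s[OF FN[OF \<open>i \<in> F\<close>]] \<open>0 < real M\<close> by (simp add: field_simps)
    qed
    also have "\<dots> = 5 / real M * (\<Sum>i\<in>F. f i - f (i - s i))"
      by (simp add: sum_distrib_left)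
    \<comment> \<open>Any upper bound of \<open>F\<close> would serve as the last endpoint;
      inserting 0 covers the empty \<open>F\<close>.\<close>
    also have "\<dots> \<le> 5 / real M * (f (Max (insert 0 F)) - A)"
    proof (intro mult_left_mono mono_disjoint_increments_le assms(1) A \<open>finite F\<close>)
      show "pairwise (\<lambda>t u. disjnt {t - s t..t} {u - s u..u}) F"
        using pairwise_subset[OF C(3) \<open>F \<subseteq> C\<close>] unfolding cb .
    qed (use s[OF FN] \<open>finite F\<close> in auto)
    also have "\<dots> \<le> 5 / real M * D"
      using B[of "Max (insert 0 F)"] \<open>0 < real M\<close> by (intro mult_left_mono) (auto simp: D_def)
    also have "\<dots> \<le> e" using M \<open>e > 0\<close> \<open>0 < real M\<close> by (simp add: field_simps)
    finally show ?thesis .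
  qed
  show "\<exists>T. ?N \<subseteq> T \<and> T \<in> lmeasurable \<and> measure lebesgue T \<le> e"
  proof (intro exI conjI)
    show "?N \<subseteq> (\<Union>i\<in>C. cball (a i) (5 * r i))" by (rule C)
    show "(\<Union>i\<in>C. cball (a i) (5 * r i)) \<in> lmeasurable"
      by (rule fmeasurable_UN_bound[OF C(1) _ bound]) auto
    show "measure lebesgue (\<Union>i\<in>C. cball (a i) (5 * r i)) \<le> e"
      by (rule measure_UN_bound[OF C(1) _ bound]) auto
  qed
qed

section \<open>Null sets recognised on parallel lines\<close>

text \<open>The direction used later, \<open>uniform_shift\<close>, need not be a coordinate axis.
  Translation invariance gives Fubini's theorem along an arbitrary \<open>e\<close> without a change
  of coordinates.\<close>

lemma null_sets_lborel_if_negligible_lines: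
  fixes S :: "'a::euclidean_space set"
  assumes [measurable]: "S \<in> sets borel"
    and lines: "\<And>p. negligible {t::real. p + t *\<^sub>R e \<in> S}"
  shows "S \<in> null_sets lborel"
proof -
  have [measurable]: "(\<lambda>(p, t). p + t *\<^sub>R e) \<in> borel_measurable (lborel \<Otimes>\<^sub>M lborel)"
    by measurable
  \<comment> \<open>Average the measure of \<open>S\<close> over its translates by \<open>t e\<close>, then exchange the integrals.\<close>
  have shift: "(\<integral>\<^sup>+p. indicator S (p + t *\<^sub>R e) \<partial>lborel) = emeasure lborel S" for t :: real
  proof -
    have "emeasure lborel S = (\<integral>\<^sup>+p. indicator S p \<partial>distr lborel borel ((+) (t *\<^sub>R e)))"
      by (simp add: lborel_distr_plus)
    also have "\<dots> = (\<integral>\<^sup>+p. indicator S (t *\<^sub>R e + p) \<partial>lborel)"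
      by (subst nn_integral_distr) auto
    finally show ?thesis by (simp add: add.commute)
  qed
  have "emeasure lborel S = (\<integral>\<^sup>+t. indicator {0..1::real} t * emeasure lborel S \<partial>lborel)"
    by (simp add: nn_integral_multc)
  also have "\<dots> = (\<integral>\<^sup>+t. (\<integral>\<^sup>+p. indicator {0..1::real} t * indicator S (p + t *\<^sub>R e) \<partial>lborel) \<partial>lborel)"
    by (intro nn_integral_cong) (subst nn_integral_cmult, measurable, simp add: shift)
  also have "\<dots> = (\<integral>\<^sup>+p. (\<integral>\<^sup>+t. indicator {0..1::real} t * indicator S (p + t *\<^sub>R e) \<partial>lborel) \<partial>lborel)"
    by (rule lborel_pair.Fubini') measurable
  also have "\<dots> = (\<integral>\<^sup>+p. 0 \<partial>(lborel :: 'a measure))"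
  proof (rule nn_integral_cong)
    fix p :: 'a
    have "{t::real. p + t *\<^sub>R e \<in> S} \<in> sets lborel" by measurable
    moreover have "{t::real. p + t *\<^sub>R e \<in> S} \<in> null_sets lebesgue"
      using lines negligible_iff_null_sets by blast
    ultimately have "{t::real. p + t *\<^sub>R e \<in> S} \<in> null_sets lborel"
      by (auto simp: null_sets_def)
    then have "AE t in lborel. p + t *\<^sub>R e \<notin> S"
      by (rule AE_I') auto
    then show "(\<integral>\<^sup>+t. indicator {0..1::real} t * indicator S (p + t *\<^sub>R e) \<partial>lborel) = 0"
      by (subst nn_integral_0_iff_AE) (auto simp: indicator_def elim: eventually_mono)
  qed
  finally show ?thesis by (auto simp: null_sets_def)
qed

section \<open>Sard's theorem in equal dimensions\<close>

text \<open>\<open>baby_Sard\<close> is stated for index types of class \<open>wellorder\<close>, an instance that the index types of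
  the theorem need not have.\<close>

typedef (overloaded) ('a::euclidean_space) basis_index = "{..<DIM('a)}"
  using DIM_positive[where 'a='a] by blast

instantiation basis_index :: (euclidean_space) wellorder
begin
definition "i \<le> j \<longleftrightarrow> Rep_basis_index i \<le> Rep_basis_index j"
definition "i < j \<longleftrightarrow> Rep_basis_index i < Rep_basis_index j"
instance
proof
  fix P :: "'a basis_index \<Rightarrow> bool" and a
  assume step: "\<And>x. (\<And>y. y < x \<Longrightarrow> P y) \<Longrightarrow> P x"
  show "P a"
    by (induction a rule: measure_induct_rule[where f=Rep_basis_index])
      (auto intro: step simp: less_basis_index_def)
qed (auto simp: less_eq_basis_index_def less_basis_index_def Rep_basis_index_inject)
end

lemma card_basis_index: "card (UNIV :: 'a::euclidean_space basis_index set) = DIM('a)"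
  by (simp add: type_definition.card[OF type_definition_basis_index])

instance basis_index :: (euclidean_space) finite
  by standard (metis card_basis_index DIM_positive card.infinite less_numeral_extra(3))

lemma negligible_linear_imageD:
  fixes F :: "'a::euclidean_space \<Rightarrow> 'b::euclidean_space"
  assumes "negligible (F ` S)" "DIM('b) \<le> DIM('a)" "linear G" "\<And>x. G (F x) = x"
  shows "negligible S"
proof -
  have "negligible (G ` (F ` S))"
    by (rule negligible_differentiable_image_negligible[OF assms(2,1)])
      (simp add: assms(3) linear_imp_differentiable_on)
  then show ?thesis using assms(4) by (simp add: image_image)
qed

text \<open>Linear isomorphisms \<open>P\<close> and \<open>Q\<close> move both spaces to the same
  \<open>real^'a basis_index\<close>. There, a derivative that is not onto has a matrix of deficient
  rank, which is the form that \<open>baby_Sard\<close> asks for; \<open>Q'\<close> brings the null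
  image back.\<close>

theorem sard_equal_dimensions:
  fixes f :: "'a::euclidean_space \<Rightarrow> 'b::euclidean_space"
  assumes dim: "DIM('a) = DIM('b)"
    and der: "\<And>x. x \<in> S \<Longrightarrow> (f has_derivative f' x) (at x within S)"
    and sing: "\<And>x. x \<in> S \<Longrightarrow> \<not> surj (f' x)"
  shows "negligible (f ` S)"
proof -
  obtain P :: "'a \<Rightarrow> real^'a basis_index" and P' where P: "linear P" "linear P'"
    "\<And>x. P' (P x) = x" "\<And>y. P (P' y) = y"
    by (rule isomorphisms_UNIV_UNIV[where 'M='a and 'N="real^'a basis_index"])
      (simp add: card_basis_index, blast)
  obtain Q :: "'b \<Rightarrow> real^'a basis_index" and Q' where Q: "linear Q" "linear Q'"
    "\<And>x. Q' (Q x) = x" "\<And>y. Q (Q' y) = y"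
    by (rule isomorphisms_UNIV_UNIV[where 'M='b and 'N="real^'a basis_index"])
      (simp add: card_basis_index dim, blast)
  have lin: "linear (\<lambda>v. Q (f' x (P' v)))" if "x \<in> S" for x
    using linear_compose[OF P(2) linear_compose[OF has_derivative_linear[OF der[OF that]] Q(1)]]
    by (simp add: o_def)
  define F where "F = (\<lambda>u. Q (f (P' u)))"
  define F' where "F' u = (\<lambda>v. Q (f' (P' u) (P' v)))" for u
  have "(F has_derivative F' u) (at u within P ` S)" if "u \<in> P ` S" for u
  proof -
    obtain x where x: "x \<in> S" "u = P x" using \<open>u \<in> P ` S\<close> by auto
    have "P' ` P ` S = S" using P(3) by (force simp: image_image)
    then have "(f has_derivative f' x) (at (P' u) within P' ` P ` S)"
      using der[OF x(1)] by (simp add: x P)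
    moreover have "(P' has_derivative P') (at u within P ` S)"
      by (simp add: P linear_imp_has_derivative)
    ultimately have "(f \<circ> P' has_derivative f' x \<circ> P') (at u within P ` S)"
      by (rule diff_chain_within[rotated])
    moreover have "bounded_linear Q" using Q(1) by (simp only: linear_conv_bounded_linear)
    ultimately have "((\<lambda>u. Q ((f \<circ> P') u)) has_derivative (\<lambda>v. Q ((f' x \<circ> P') v))) (at u within P ` S)"
      by (rule bounded_linear.has_derivative[rotated])
    then show ?thesis by (simp add: F_def F'_def o_def x(2) P(3))
  qed
  moreover have "rank (matrix (F' u)) < CARD('a basis_index)" if "u \<in> P ` S" for u
  proof -
    obtain x where x: "x \<in> S" "u = P x" using \<open>u \<in> P ` S\<close> by auto
    have F'u: "F' u = (\<lambda>v. Q (f' x (P' v)))" by (simp add: F'_def x(2) P(3))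
    have "\<not> surj (F' u)"
    proof
      assume s: "surj (F' u)"
      have "\<exists>v. f' x v = w" for w
      proof -
        obtain v where "Q w = F' u v" using s by (metis surjD)
        then have "f' x (P' v) = w" unfolding F'u using Q(3) by metis
        then show ?thesis ..
      qed
      then have "surj (f' x)" unfolding surj_def by metis
      then show False using sing[OF x(1)] by blast
    qed
    moreover have "surj (F' u)" if "rank (matrix (F' u)) = CARD('a basis_index)"
    proof -
      have "(*v) (matrix (F' u)) = F' u"
        using lin[OF x(1)] unfolding F'u[symmetric] by (simp add: fun_eq_iff matrix_works)
      then show ?thesis using that by (simp add: full_rank_surjective)
    qed
    ultimately show ?thesis
      using rank_bound[of "matrix (F' u)"] by fastforce
  qed
  ultimately have "negligible (F ` (P ` S))"
    by (rule baby_Sard[OF order_refl])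
  then have "negligible (Q ` (f ` S))"
    by (simp add: image_image P F_def)
  then show ?thesis
    by (rule negligible_linear_imageD[where G=Q']) (simp_all add: Q dim card_basis_index)
qed

section \<open>Second-order expansions\<close>

lemma eventually_less_linear_at_right:
  fixes f :: "real \<Rightarrow> real"
  assumes "(f has_real_derivative l) (at 0)" "l < k"
  shows "eventually (\<lambda>t. f t < f 0 + t * k) (at_right 0)"
proof -
  have "((\<lambda>t. (f t - f 0) / t) \<longlongrightarrow> l) (at_right 0)"
    using has_field_derivative_at_within[OF assms(1), of "{0<..}"]
    by (simp add: has_field_derivative_iff)
  then have "eventually (\<lambda>t. (f t - f 0) / t < k) (at_right 0)"
    using assms(2) by (rule order_tendstoD)
  moreover have "eventually (\<lambda>t::real. t > 0) (at_right 0)"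
    by (simp add: eventually_at_right_less)
  ultimately show ?thesis
    by eventually_elim (simp add: field_simps)
qed

text \<open>One use of l'Hopital's rule leaves half the difference quotient of \<open>f'\<close> at
  0, so \<open>f'\<close> has to be differentiable at that single point only.\<close>

lemma second_order_taylor_at_right:
  fixes f f' :: "real \<Rightarrow> real"
  assumes f: "\<And>t. (f has_real_derivative f' t) (at t)"
    and f': "(f' has_real_derivative l) (at 0)"
  shows "((\<lambda>t. (f t - f 0 - t * f' 0) / t\<^sup>2) \<longlongrightarrow> l / 2) (at_right 0)"
proof (rule lhopital_right_0)
  have "isCont f 0" using f DERIV_isCont by blast
  then show "((\<lambda>t. f t - f 0 - t * f' 0) \<longlongrightarrow> 0) (at_right 0)"
    by (auto intro!: tendsto_eq_intros simp: isCont_def filterlim_at_split)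
  show "((\<lambda>t::real. t\<^sup>2) \<longlongrightarrow> 0) (at_right 0)"
    by (auto intro!: tendsto_eq_intros)
  have pos: "eventually (\<lambda>t::real. t > 0) (at_right 0)"
    by (simp add: eventually_at_right_less)
  show "eventually (\<lambda>t::real. t\<^sup>2 \<noteq> 0) (at_right 0)" "eventually (\<lambda>t::real. 2 * t \<noteq> 0) (at_right 0)"
    using pos by (auto elim: eventually_mono)
  show "eventually (\<lambda>t. ((\<lambda>t. f t - f 0 - t * f' 0) has_real_derivative f' t - f' 0) (at t)) (at_right 0)"
    by (intro always_eventually allI) (auto intro!: derivative_eq_intros f)
  show "eventually (\<lambda>t::real. ((\<lambda>t. t\<^sup>2) has_real_derivative 2 * t) (at t)) (at_right 0)"
    by (intro always_eventually allI) (auto intro!: derivative_eq_intros)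
  have "((\<lambda>t. (f' t - f' 0) / t) \<longlongrightarrow> l) (at_right 0)"
    using has_field_derivative_at_within[OF f', of "{0<..}"]
    by (simp add: has_field_derivative_iff)
  then have "((\<lambda>t. (f' t - f' 0) / t / 2) \<longlongrightarrow> l / 2) (at_right 0)"
    by (intro tendsto_intros) auto
  then show "((\<lambda>t. (f' t - f' 0) / (2 * t)) \<longlongrightarrow> l / 2) (at_right 0)"
    by (simp add: mult.commute)
qed

text \<open>The restriction to the parabola has derivative
  \<open>u (p t) \<bullet> (d + (2 * t) *\<^sub>R w)\<close>. Differentiating again at 0 gives twice
  the claimed limit: the bending \<open>w\<close> enters at second order, paired with the
  gradient.\<close>

lemma second_order_taylor_along_parabola:
  fixes f :: "'a::euclidean_space \<Rightarrow> real"
  assumes f: "\<And>z. GDERIV f z :> u z" and u: "(u has_derivative u') (at y)"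
  shows "((\<lambda>t. (f (y + t *\<^sub>R d + t\<^sup>2 *\<^sub>R w) - f y - t * (u y \<bullet> d)) / t\<^sup>2)
    \<longlongrightarrow> u y \<bullet> w + d \<bullet> u' d / 2) (at_right 0)"
proof -
  define p where "p t = y + t *\<^sub>R d + t\<^sup>2 *\<^sub>R w" for t :: real
  have p: "(p has_derivative (\<lambda>s. s *\<^sub>R (d + (2 * t) *\<^sub>R w))) (at t)" for t
    unfolding p_def by (auto intro!: derivative_eq_intros simp: algebra_simps)
  have p0: "p 0 = y" by (simp add: p_def)
  have 1: "((\<lambda>t. f (p t)) has_real_derivative u (p t) \<bullet> (d + (2 * t) *\<^sub>R w)) (at t)" for t
    unfolding has_field_derivative_def
    by (rule has_derivative_eq_rhs[OF has_derivative_compose[OF p f[unfolded gderiv_def]]])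
      (simp add: fun_eq_iff inner_commute mult.commute)
  have "(u has_derivative u') (at (p 0))" using u p0 by simp
  from has_derivative_compose[OF p this]
  have "((\<lambda>t. u (p t)) has_derivative (\<lambda>s. u' (s *\<^sub>R d))) (at 0)"
    by simp
  moreover have "u' (s *\<^sub>R d) = s *\<^sub>R u' d" for s
    using has_derivative_linear[OF u] by (simp add: linear_cmul)
  ultimately have up: "((\<lambda>t. u (p t)) has_derivative (\<lambda>s. s *\<^sub>R u' d)) (at 0)"
    by simp
  have q: "((\<lambda>t. d + (2 * t) *\<^sub>R w) has_derivative (\<lambda>s. (2 * s) *\<^sub>R w)) (at 0)"
    by (auto intro!: derivative_eq_intros)
  have 2: "((\<lambda>t. u (p t) \<bullet> (d + (2 * t) *\<^sub>R w)) has_real_derivative 2 * (u y \<bullet> w) + d \<bullet> u' d) (at 0)"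
    unfolding has_field_derivative_def
    by (rule has_derivative_eq_rhs[OF has_derivative_inner[OF up q]])
      (simp add: fun_eq_iff p0 algebra_simps inner_commute)
  have "((\<lambda>t. (f (p t) - f (p 0) - t * (u (p 0) \<bullet> (d + (2 * 0) *\<^sub>R w))) / t\<^sup>2)
    \<longlongrightarrow> (2 * (u y \<bullet> w) + d \<bullet> u' d) / 2) (at_right 0)"
    by (rule second_order_taylor_at_right[OF 1 2])
  then show ?thesis by (simp add: p0 p_def add_divide_distrib)
qed

section \<open>Symmetry of the second derivative\<close>

text \<open>The second difference is the increment of \<open>g\<close> over [0, 1], where
  \<open>g\<close> compares two parallel segments in direction \<open>v\<close>. The mean value
  theorem reduces it to a difference of two values of \<open>u\<close>, and both are linearised at
  \<open>y\<close>.\<close>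

lemma second_difference_quotient_tendsto:
  fixes f :: "'a::euclidean_space \<Rightarrow> real"
  assumes f: "\<And>z. GDERIV f z :> u z" and u: "(u has_derivative u') (at y)"
  shows "((\<lambda>t. (f (y + t *\<^sub>R v + t *\<^sub>R w) - f (y + t *\<^sub>R v) - f (y + t *\<^sub>R w) + f y) / t\<^sup>2)
    \<longlongrightarrow> v \<bullet> u' w) (at_right 0)"
proof (rule tendstoI)
  fix e :: real assume "e > 0"
  \<comment> \<open>After division by \<open>t\<close>, the two linearisation errors paired with
    \<open>v\<close> are at most \<open>e' * (K - 1)\<close>; the added 1 makes \<open>K\<close>
    positive, and \<open>e' * K\<close> equals \<open>e / 2\<close>.\<close>
  define K where "K = norm v * (2 * norm v + 2 * norm w) + 1"
  have "K > 0" by (simp add: K_def add_nonneg_pos)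
  define e' where "e' = e / (2 * K)"
  have "e' > 0" using \<open>e > 0\<close> \<open>K > 0\<close> by (simp add: e'_def)
  then obtain r where "r > 0" and r: "\<And>z. norm (z - y) < r \<Longrightarrow> norm (u z - u y - u' (z - y)) \<le> e' * norm (z - y)"
    using u unfolding has_derivative_at_alt by blast
  have R: "norm (u (y + h) - u y - u' h) \<le> e' * norm h" if "norm h < r" for h
    using r[of "y + h"] that by simp
  have lin: "linear u'" using u has_derivative_linear by blast
  define \<delta> where "\<delta> = r / (norm v + norm w + 1)"
  have den: "norm v + norm w + 1 > 0" by (simp add: add_nonneg_pos)
  then have "\<delta> > 0" using \<open>r > 0\<close> by (simp add: \<delta>_def)
  have "dist ((f (y + t *\<^sub>R v + t *\<^sub>R w) - f (y + t *\<^sub>R v) - f (y + t *\<^sub>R w) + f y) / t\<^sup>2) (v \<bullet> u' w) < e"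
    if t: "0 < t" "t < \<delta>" for t
  proof -
    have tr: "t * (norm v + norm w) < r"
    proof -
      have "t * (norm v + norm w) \<le> t * (norm v + norm w + 1)" using t by simp
      also have "\<dots> < r" using t den by (simp add: \<delta>_def field_simps)
      finally show ?thesis .
    qed
    define g where "g = (\<lambda>\<tau>. f (y + (\<tau> * t) *\<^sub>R v + t *\<^sub>R w) - f (y + (\<tau> * t) *\<^sub>R v))"
    have g: "(g has_real_derivative t * (v \<bullet> (u (y + (\<tau> * t) *\<^sub>R v + t *\<^sub>R w) - u (y + (\<tau> * t) *\<^sub>R v)))) (at \<tau>)" for \<tau>
    proof -
      have "((\<lambda>\<tau>. y + (\<tau> * t) *\<^sub>R v + t *\<^sub>R w) has_derivative (\<lambda>s. (s * t) *\<^sub>R v)) (at \<tau>)"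
           "((\<lambda>\<tau>. y + (\<tau> * t) *\<^sub>R v) has_derivative (\<lambda>s. (s * t) *\<^sub>R v)) (at \<tau>)"
        by (auto intro!: derivative_eq_intros)
      note D = has_derivative_diff[OF has_derivative_compose[OF this(1) f[unfolded gderiv_def]]
          has_derivative_compose[OF this(2) f[unfolded gderiv_def]]]
      show ?thesis unfolding g_def has_field_derivative_def
        by (rule has_derivative_eq_rhs[OF D]) (simp add: fun_eq_iff algebra_simps inner_diff_right)
    qed
    obtain \<xi> where \<xi>: "0 < \<xi>" "\<xi> < 1"
      "g 1 - g 0 = (1 - 0) * (t * (v \<bullet> (u (y + (\<xi> * t) *\<^sub>R v + t *\<^sub>R w) - u (y + (\<xi> * t) *\<^sub>R v))))"
      using MVT2[of 0 1 g, OF _ g] by auto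
    define h1 h2 where "h1 = (\<xi> * t) *\<^sub>R v + t *\<^sub>R w" and "h2 = (\<xi> * t) *\<^sub>R v"
    have xt: "\<xi> * t \<le> t" using \<xi> t by simp
    have h2: "norm h2 \<le> t * norm v"
      using \<xi> t xt by (simp add: h2_def mult_right_mono)
    have "norm h1 \<le> norm h2 + t * norm w"
      using norm_triangle_ineq[of h2 "t *\<^sub>R w"] t by (simp add: h1_def h2_def)
    then have h1: "norm h1 \<le> t * (norm v + norm w)" using h2 by (simp add: algebra_simps)
    have h2': "norm h2 \<le> t * (norm v + norm w)"
      using h2 t by (simp add: algebra_simps add_increasing2)
    define E where "E = (u (y + h1) - u y - u' h1) - (u (y + h2) - u y - u' h2)"
    have E: "norm E \<le> e' * (2 * (t * (norm v + norm w)))"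
    proof -
      have "norm E \<le> e' * norm h1 + e' * norm h2"
        unfolding E_def using R[of h1] R[of h2] h1 h2' tr norm_triangle_ineq4 by (smt (verit))
      also have "\<dots> \<le> e' * (2 * (t * (norm v + norm w)))"
        using h1 h2' \<open>e' > 0\<close> by (simp add: distrib_left[symmetric])
      finally show ?thesis .
    qed
    have "u' h1 - u' h2 = t *\<^sub>R u' w"
      using lin by (simp add: h1_def h2_def linear_add linear_cmul)
    then have "u (y + h1) - u (y + h2) = t *\<^sub>R u' w + E"
      by (simp add: E_def algebra_simps)
    then have "g 1 - g 0 = t * (v \<bullet> (t *\<^sub>R u' w + E))"
      using \<xi>(3) by (simp add: h1_def h2_def add.assoc)
    then have "g 1 - g 0 = t\<^sup>2 * (v \<bullet> u' w) + t * (v \<bullet> E)"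
      by (simp add: inner_add_right algebra_simps power2_eq_square)
    then have eq: "(g 1 - g 0) / t\<^sup>2 - v \<bullet> u' w = (v \<bullet> E) / t"
      using t by (simp add: field_simps power2_eq_square)
    have "\<bar>v \<bullet> E\<bar> \<le> norm v * (e' * (2 * (t * (norm v + norm w))))"
      using Cauchy_Schwarz_ineq2[of v E] E by (meson mult_left_mono norm_ge_zero order_trans)
    then have "\<bar>(v \<bullet> E) / t\<bar> \<le> e' * (norm v * (2 * norm v + 2 * norm w))"
      using t by (simp add: field_simps)
    also have "\<dots> \<le> e' * K" using \<open>e' > 0\<close> by (simp add: K_def)
    also have "\<dots> < e" using \<open>e > 0\<close> \<open>K > 0\<close> by (simp add: e'_def)
    finally have "\<bar>(g 1 - g 0) / t\<^sup>2 - v \<bullet> u' w\<bar> < e" using eq by simp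
    moreover have "g 1 - g 0 = f (y + t *\<^sub>R v + t *\<^sub>R w) - f (y + t *\<^sub>R v) - f (y + t *\<^sub>R w) + f y"
      by (simp add: g_def)
    ultimately show ?thesis by (simp add: dist_real_def)
  qed
  then show "eventually (\<lambda>t. dist ((f (y + t *\<^sub>R v + t *\<^sub>R w) - f (y + t *\<^sub>R v) - f (y + t *\<^sub>R w) + f y) / t\<^sup>2)
      (v \<bullet> u' w) < e) (at_right 0)"
    unfolding eventually_at_right_field using \<open>\<delta> > 0\<close> by auto
qed

text \<open>The second difference quotient does not change when \<open>v\<close> and
  \<open>w\<close> are exchanged, and its limit is unique.\<close>

lemma derivative_of_gradient_symmetric:
  fixes f :: "'a::euclidean_space \<Rightarrow> real"
  assumes f: "\<And>z. GDERIV f z :> u z" and u: "(u has_derivative u') (at y)"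
  shows "v \<bullet> u' w = w \<bullet> u' v"
proof (rule tendsto_unique[OF _ second_difference_quotient_tendsto[OF assms]])
  show "((\<lambda>t. (f (y + t *\<^sub>R v + t *\<^sub>R w) - f (y + t *\<^sub>R v) - f (y + t *\<^sub>R w) + f y) / t\<^sup>2)
    \<longlongrightarrow> w \<bullet> u' v) (at_right 0)"
    using second_difference_quotient_tendsto[OF assms, of w v] by (simp add: algebra_simps)
qed simp

section \<open>Optimality conditions at calm minimizers\<close>

text \<open>Equivalently, \<open>y\<close> competes with nearby \<open>z\<close> under the exact penalty \<open>M max 0 (max\<^sub>i (c i z))\<close>.\<close>

definition calm_at :: "('a::metric_space \<Rightarrow> real) \<Rightarrow> ('k \<Rightarrow> 'a \<Rightarrow> real) \<Rightarrow> 'a \<Rightarrow> real \<Rightarrow> bool" where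
  "calm_at f c y M \<longleftrightarrow> 0 \<le> M \<and>
     (\<exists>e>0. \<forall>z\<in>ball y e. \<forall>s\<ge>0. (\<forall>i. c i z \<le> s) \<longrightarrow> f y \<le> f z + M * s)"

lemma calm_at_along_curve:
  fixes c :: "'k::finite \<Rightarrow> 'a::metric_space \<Rightarrow> real"
  assumes "calm_at f c y M" and "(p \<longlongrightarrow> y) F"
    and "eventually (\<lambda>t. 0 \<le> s t) F" and "\<And>i. eventually (\<lambda>t. c i (p t) \<le> s t) F"
  shows "eventually (\<lambda>t. f y \<le> f (p t) + M * s t) F"
proof -
  obtain e where "e > 0" and e: "\<And>z s. z \<in> ball y e \<Longrightarrow> 0 \<le> s \<Longrightarrow> \<forall>i. c i z \<le> s \<Longrightarrow> f y \<le> f z + M * s"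
    using assms(1) unfolding calm_at_def by blast
  have "eventually (\<lambda>t. p t \<in> ball y e) F"
    using tendstoD[OF assms(2) \<open>e > 0\<close>] by (simp add: dist_commute)
  moreover have "eventually (\<lambda>t. \<forall>i. c i (p t) \<le> s t) F"
    using assms(4) by (simp add: eventually_all_finite)
  ultimately show ?thesis using assms(3)
    by eventually_elim (use e in blast)
qed

text \<open>Calmness, linearised along \<open>y + t d\<close>: the active constraints grow at a rate
  of at most \<open>s\<close> up to an arbitrarily small error, the inactive ones stay negative for
  small \<open>t\<close>, and the penalty pays for the violation.\<close>

lemma calm_at_directional:
  fixes c :: "'k::finite \<Rightarrow> 'a::euclidean_space \<Rightarrow> real"
  assumes calm: "calm_at f c y M" and f: "GDERIV f y :> u" and c: "\<And>i. GDERIV (c i) y :> v i"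
    and feas: "\<And>i. c i y \<le> 0"
    and s: "0 \<le> s" "\<And>i. c i y = 0 \<Longrightarrow> v i \<bullet> d \<le> s"
  shows "0 \<le> u \<bullet> d + M * s"
proof (rule ccontr)
  assume neg: "\<not> 0 \<le> u \<bullet> d + M * s"
  have "0 \<le> M" using calm by (simp add: calm_at_def)
  \<comment> \<open>Solves \<open>u \<bullet> d + \<epsilon> + M * (s + \<epsilon>) = 0\<close>: the
    assumed gap is used up exactly, and the strict inequality along the line then reads 0 <
    0.\<close>
  define \<epsilon> where "\<epsilon> = - (u \<bullet> d + M * s) / (1 + M)"
  have \<epsilon>: "\<epsilon> > 0" "u \<bullet> d + \<epsilon> + M * (s + \<epsilon>) = 0"
    using neg \<open>0 \<le> M\<close> by (auto simp: \<epsilon>_def field_simps)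
  define p where "p t = y + t *\<^sub>R d" for t :: real
  have p0: "p 0 = y" by (simp add: p_def)
  have p: "(p has_derivative (\<lambda>h. h *\<^sub>R d)) (at 0)"
    unfolding p_def by (auto intro!: derivative_eq_intros)
  have along: "((\<lambda>t. k (p t)) has_real_derivative w \<bullet> d) (at 0)" if "GDERIV k y :> w" for k w
  proof -
    have "(k has_derivative (\<lambda>h. h \<bullet> w)) (at (p 0))"
      using that by (simp add: gderiv_def p0)
    note D = has_derivative_compose[OF p this]
    show ?thesis unfolding has_field_derivative_def
      by (rule has_derivative_eq_rhs[OF D]) (simp add: fun_eq_iff inner_commute mult.commute)
  qed
  have pos: "eventually (\<lambda>t::real. t > 0) (at_right 0)"
    by (simp add: eventually_at_right_less)
  have pcont: "(p \<longlongrightarrow> y) (at_right 0)"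
    unfolding p_def by (auto intro!: tendsto_eq_intros)
  have cev: "eventually (\<lambda>t. c i (p t) \<le> t * (s + \<epsilon>)) (at_right 0)" for i
  proof (cases "c i y = 0")
    case True
    then have "v i \<bullet> d < s + \<epsilon>" using s(2) \<epsilon>(1) by force
    from eventually_less_linear_at_right[OF along[OF c] this]
    show ?thesis by eventually_elim (simp add: p0 True)
  next
    case False
    then have "c i y < 0" using feas[of i] by simp
    have "isCont (c i) y" using c[of i] has_derivative_continuous by (auto simp: gderiv_def)
    then have "((\<lambda>t. c i (p t)) \<longlongrightarrow> c i y) (at_right 0)"
      using pcont isCont_tendsto_compose by blast
    then have "eventually (\<lambda>t. c i (p t) < 0) (at_right 0)"
      using \<open>c i y < 0\<close> by (rule order_tendstoD)
    then show ?thesis using pos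
      by eventually_elim (use s(1) \<epsilon>(1) in \<open>smt (verit) mult_nonneg_nonneg\<close>)
  qed
  have "eventually (\<lambda>t. f y \<le> f (p t) + M * (t * (s + \<epsilon>))) (at_right 0)"
    by (rule calm_at_along_curve[OF calm pcont _ cev])
      (use pos in eventually_elim, use s(1) \<epsilon>(1) in simp)
  moreover have "eventually (\<lambda>t. f (p t) < f (p 0) + t * (u \<bullet> d + \<epsilon>)) (at_right 0)"
    by (rule eventually_less_linear_at_right[OF along[OF f]]) (use \<epsilon> in simp)
  ultimately have "eventually (\<lambda>t. False) (at_right (0::real))"
  proof eventually_elim
    case (elim t)
    then have "0 < t * (u \<bullet> d + \<epsilon> + M * (s + \<epsilon>))" by (simp add: p0 algebra_simps)
    then show False by (simp add: \<epsilon>(2))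
  qed
  then show False by simp
qed

text \<open>No constraint qualification is available here. The calmness constant bounds the total
  mass of the multipliers, so the candidates form a compact convex set \<Lambda>. If
  \<open>- u\<close> were outside its image, a separating direction would violate
  \<open>calm_at_directional\<close>.\<close>

lemma calm_at_multiplier:
  fixes c :: "'k::finite \<Rightarrow> 'a::euclidean_space \<Rightarrow> real"
  assumes calm: "calm_at f c y M" and f: "GDERIV f y :> u" and c: "\<And>i. GDERIV (c i) y :> v i"
    and feas: "\<And>i. c i y \<le> 0"
  obtains l :: "real^'k" where "\<And>i. 0 \<le> l $ i" "\<And>i. l $ i * c i y = 0"
    "u + (\<Sum>i\<in>UNIV. l $ i *\<^sub>R v i) = 0"
proof -
  have "0 \<le> M" using calm by (simp add: calm_at_def)
  define \<Lambda> :: "(real^'k) set" where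
    "\<Lambda> = {l. (\<forall>i. 0 \<le> l $ i) \<and> (\<Sum>i\<in>UNIV. l $ i) \<le> M \<and> (\<forall>i. c i y \<noteq> 0 \<longrightarrow> l $ i = 0)}"
  define T where "T = (\<lambda>l :: real^'k. \<Sum>i\<in>UNIV. l $ i *\<^sub>R v i)"
  have linT: "linear T"
    by (rule linearI) (simp_all add: T_def scaleR_add_left sum.distrib scaleR_sum_right)
  have "closed \<Lambda>"
    unfolding \<Lambda>_def
    by (intro closed_Collect_conj closed_Collect_all closed_Collect_le closed_Collect_imp
        closed_Collect_eq continuous_intros open_Collect_const)
  moreover have "\<Lambda> \<subseteq> cbox 0 (\<chi> i. M)"
  proof
    fix l assume l: "l \<in> \<Lambda>"
    then have "l $ i \<le> (\<Sum>i\<in>UNIV. l $ i)" for i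
      by (intro member_le_sum) (auto simp: \<Lambda>_def)
    then show "l \<in> cbox 0 (\<chi> i. M)"
      using l by (auto simp: mem_box_cart \<Lambda>_def intro: order_trans)
  qed
  ultimately have "compact \<Lambda>"
    using bounded_subset bounded_cbox compact_eq_bounded_closed by blast
  then have "closed (T ` \<Lambda>)"
    using linT by (intro compact_imp_closed compact_continuous_image)
      (simp_all add: linear_continuous_on linear_conv_bounded_linear)
  moreover have "convex (T ` \<Lambda>)"
  proof (rule convex_linear_image[OF linT])
    show "convex \<Lambda>"
    proof (rule convexI)
      fix l m and a b :: real
      assume lm: "l \<in> \<Lambda>" "m \<in> \<Lambda>" and ab: "0 \<le> a" "0 \<le> b" "a + b = 1"
      have "(\<Sum>i\<in>UNIV. (a *\<^sub>R l + b *\<^sub>R m) $ i) = a * (\<Sum>i\<in>UNIV. l $ i) + b * (\<Sum>i\<in>UNIV. m $ i)"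
        by (simp add: sum.distrib sum_distrib_left)
      also have "\<dots> \<le> a * M + b * M"
        using lm ab by (intro add_mono mult_left_mono) (auto simp: \<Lambda>_def)
      also have "\<dots> = M" using ab by (simp add: distrib_right[symmetric])
      finally show "a *\<^sub>R l + b *\<^sub>R m \<in> \<Lambda>" using lm ab by (simp add: \<Lambda>_def)
    qed
  qed
  moreover have "- u \<in> T ` \<Lambda>"
  proof (rule ccontr)
    assume "- u \<notin> T ` \<Lambda>"
    then obtain d b where d: "d \<bullet> - u < b" "\<And>l. l \<in> \<Lambda> \<Longrightarrow> b < d \<bullet> T l"
      using separating_hyperplane_closed_point[of "T ` \<Lambda>" "- u"] calculation by blast
    \<comment> \<open>The largest rate of an active constraint in direction \<open>- d\<close>, cut
      off at 0; the 0 is also the value when no constraint is active.\<close>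
    define s where "s = Max (insert 0 ((\<lambda>i. v i \<bullet> (- d)) ` {i. c i y = 0}))"
    have s: "0 \<le> s" "\<And>i. c i y = 0 \<Longrightarrow> v i \<bullet> (- d) \<le> s"
      unfolding s_def by (auto intro!: Max_ge)
    \<comment> \<open>The value \<open>- M * s\<close> is attained at a vertex of \<Lambda>: at 0
      when \<open>s = 0\<close>, and otherwise at \<open>M\<close> times the unit vector of a
      maximising constraint.\<close>
    have "s \<in> insert 0 ((\<lambda>i. v i \<bullet> (- d)) ` {i. c i y = 0})"
      unfolding s_def by (rule Max_in) auto
    then have "\<exists>l\<in>\<Lambda>. d \<bullet> T l = - M * s"
    proof
      assume "s = 0"
      then show ?thesis using \<open>0 \<le> M\<close> by (intro bexI[of _ 0]) (auto simp: \<Lambda>_def T_def)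
    next
      assume "s \<in> (\<lambda>i. v i \<bullet> (- d)) ` {i. c i y = 0}"
      then obtain j where j: "s = v j \<bullet> (- d)" "c j y = 0" by blast
      have "axis j M \<in> \<Lambda>" using \<open>0 \<le> M\<close> j by (auto simp: \<Lambda>_def axis_def)
      moreover have "T (axis j M) = M *\<^sub>R v j"
        unfolding T_def axis_def by (simp add: if_distrib[of "\<lambda>x. x *\<^sub>R _"] cong: if_cong)
      ultimately show ?thesis using j by (intro bexI) (auto simp: inner_commute)
    qed
    then have "- (d \<bullet> u) < - M * s" using d by fastforce
    moreover have "0 \<le> u \<bullet> (- d) + M * s"
      by (rule calm_at_directional[OF calm f c feas s])
    ultimately show False by (simp add: inner_commute)
  qed
  then obtain l where l: "l \<in> \<Lambda>" "- u = T l" by blast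
  show thesis
  proof (rule that[of l])
    show "u + (\<Sum>i\<in>UNIV. l $ i *\<^sub>R v i) = 0" using l(2) unfolding T_def by (metis add.right_inverse)
  qed (use l(1) in \<open>auto simp: \<Lambda>_def\<close>)
qed

text \<open>The test curve need not be feasible. It violates the constraints by o(t^2), so calmness
  charges only o(t^2), whereas the objective changes by \<open>q / 2\<close> times t^2 to leading
  order, with \<open>q\<close> the quadratic form of the Lagrangian.\<close>

lemma calm_at_second_order_necessary:
  fixes c :: "'k::finite \<Rightarrow> 'a::euclidean_space \<Rightarrow> real" and l :: "real^'k"
  assumes calm: "calm_at f c y M"
    and f: "\<And>z. GDERIV f z :> u z" "(u has_derivative u') (at y)"
    and c: "\<And>i z. GDERIV (c i) z :> v i z" "\<And>i. (v i has_derivative v' i) (at y)"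
    and feas: "\<And>i. c i y \<le> 0" and compl: "\<And>i. l $ i * c i y = 0"
    and stat: "u y + (\<Sum>i\<in>UNIV. l $ i *\<^sub>R v i y) = 0"
    and licq: "\<And>\<alpha>. \<exists>w. \<forall>i. c i y = 0 \<longrightarrow> v i y \<bullet> w = \<alpha> i"
    and d: "\<And>i. c i y = 0 \<Longrightarrow> v i y \<bullet> d = 0"
  shows "0 \<le> d \<bullet> (u' d + (\<Sum>i\<in>UNIV. l $ i *\<^sub>R v' i d))"
proof (rule ccontr)
  define q where "q = d \<bullet> (u' d + (\<Sum>i\<in>UNIV. l $ i *\<^sub>R v' i d))"
  assume "\<not> 0 \<le> d \<bullet> (u' d + (\<Sum>i\<in>UNIV. l $ i *\<^sub>R v' i d))"
  then have "q < 0" by (simp add: q_def)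
  have "0 \<le> M" using calm by (simp add: calm_at_def)
  \<comment> \<open>This \<open>w\<close> makes the active constraints vanish to second order along \<open>y + t d + t\<^sup>2 w\<close>.\<close>
  obtain w where w: "\<And>i. c i y = 0 \<Longrightarrow> v i y \<bullet> w = - (d \<bullet> v' i d) / 2"
    using licq[of "\<lambda>i. - (d \<bullet> v' i d) / 2"] by blast
  have act: "l $ i = 0 \<or> c i y = 0" for i using compl[of i] by simp
  have u: "u y = - (\<Sum>i\<in>UNIV. l $ i *\<^sub>R v i y)" using stat by (simp add: eq_neg_iff_add_eq_0)
  have ud: "u y \<bullet> d = 0"
  proof -
    have "(\<Sum>i\<in>UNIV. l $ i * (v i y \<bullet> d)) = 0"
    proof (rule sum.neutral, rule ballI)
      show "l $ i * (v i y \<bullet> d) = 0" for i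
        using act[of i] d[of i] by auto
    qed
    then show ?thesis by (simp add: u inner_sum_left)
  qed
  \<comment> \<open>Stationarity turns the bending term of the objective into the curvature terms of
    the constraints, which completes the Hessian of the objective to that of the Lagrangian.\<close>
  have uw: "u y \<bullet> w = (\<Sum>i\<in>UNIV. l $ i * (d \<bullet> v' i d)) / 2"
  proof -
    have "(\<Sum>i\<in>UNIV. l $ i * (v i y \<bullet> w)) = (\<Sum>i\<in>UNIV. - (l $ i * (d \<bullet> v' i d) / 2))"
    proof (rule sum.cong[OF refl])
      show "l $ i * (v i y \<bullet> w) = - (l $ i * (d \<bullet> v' i d) / 2)" for i
        using act[of i] w[of i] by auto
    qed
    then show ?thesis by (simp add: u inner_sum_left sum_negf sum_divide_distrib)
  qed
  have q: "u y \<bullet> w + d \<bullet> u' d / 2 = q / 2"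
    by (simp add: uw q_def inner_add_right inner_sum_right add_divide_distrib)
  define p where "p t = y + t *\<^sub>R d + t\<^sup>2 *\<^sub>R w" for t :: real
  \<comment> \<open>Small enough that the penalty \<open>M * \<epsilon>\<close> stays below
    \<open>- q / 4\<close>, half of the leading decrease \<open>- q / 2\<close>.\<close>
  define \<epsilon> where "\<epsilon> = - q / (4 * (1 + M))"
  have "\<epsilon> > 0" using \<open>q < 0\<close> \<open>0 \<le> M\<close> by (simp add: \<epsilon>_def divide_neg_pos)
  have \<epsilon>: "q / 4 + M * \<epsilon> \<le> 0"
    using \<open>q < 0\<close> \<open>0 \<le> M\<close> by (simp add: \<epsilon>_def field_simps)
  have pos: "eventually (\<lambda>t::real. t > 0) (at_right 0)"
    by (simp add: eventually_at_right_less)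
  have pcont: "(p \<longlongrightarrow> y) (at_right 0)"
    unfolding p_def by (auto intro!: tendsto_eq_intros)
  have cev: "eventually (\<lambda>t. c i (p t) \<le> \<epsilon> * t\<^sup>2) (at_right 0)" for i
  proof (cases "c i y = 0")
    case True
    have "((\<lambda>t. (c i (p t) - c i y - t * (v i y \<bullet> d)) / t\<^sup>2) \<longlongrightarrow> v i y \<bullet> w + d \<bullet> v' i d / 2) (at_right 0)"
      unfolding p_def by (rule second_order_taylor_along_parabola[OF c])
    then have "((\<lambda>t. c i (p t) / t\<^sup>2) \<longlongrightarrow> 0) (at_right 0)"
      by (simp add: True w d)
    then have "eventually (\<lambda>t. c i (p t) / t\<^sup>2 < \<epsilon>) (at_right 0)"
      using \<open>\<epsilon> > 0\<close> by (rule order_tendstoD)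
    then show ?thesis using pos by eventually_elim (simp add: field_simps)
  next
    case False
    then have "c i y < 0" using feas[of i] by simp
    have "isCont (c i) y" by (rule has_derivative_continuous[OF c(1)[unfolded gderiv_def]])
    then have "((\<lambda>t. c i (p t)) \<longlongrightarrow> c i y) (at_right 0)"
      using pcont isCont_tendsto_compose by blast
    then have "eventually (\<lambda>t. c i (p t) < 0) (at_right 0)"
      using \<open>c i y < 0\<close> by (rule order_tendstoD)
    then show ?thesis
      by eventually_elim (use \<open>\<epsilon> > 0\<close> in \<open>smt (verit) mult_nonneg_nonneg zero_le_power2\<close>)
  qed
  have "eventually (\<lambda>t. f y \<le> f (p t) + M * (\<epsilon> * t\<^sup>2)) (at_right 0)"
    by (rule calm_at_along_curve[OF calm pcont _ cev]) (use \<open>\<epsilon> > 0\<close> in simp)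
  moreover have "eventually (\<lambda>t. (f (p t) - f y) / t\<^sup>2 < q / 4) (at_right 0)"
  proof -
    have "((\<lambda>t. (f (p t) - f y - t * (u y \<bullet> d)) / t\<^sup>2) \<longlongrightarrow> u y \<bullet> w + d \<bullet> u' d / 2) (at_right 0)"
      unfolding p_def by (rule second_order_taylor_along_parabola[OF f])
    then have "((\<lambda>t. (f (p t) - f y) / t\<^sup>2) \<longlongrightarrow> q / 2) (at_right 0)"
      by (simp add: q ud)
    then show ?thesis by (rule order_tendstoD) (use \<open>q < 0\<close> in simp)
  qed
  ultimately have "eventually (\<lambda>t. False) (at_right (0::real))" using pos
  proof eventually_elim
    case (elim t)
    then have "0 < t\<^sup>2 * (q / 4 + M * \<epsilon>)" by (simp add: field_simps)
    then show False using \<epsilon> by (simp add: zero_less_mult_iff)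
  qed
  then show False by simp
qed

section \<open>Calmness for almost every perturbation\<close>

text \<open>For compact \<open>B\<close> and continuous data, these are the parameters whose minimal
  value over \<open>B\<close> is at most \<open>c\<close>. Stating this through a witness
  \<open>y\<close> makes the set a projection and avoids the value of an infeasible problem.\<close>

definition sublevel_params ::
  "('x \<times> 'y::euclidean_space \<Rightarrow> real) \<Rightarrow> ('k::finite \<Rightarrow> 'x::euclidean_space \<times> 'y \<Rightarrow> real) \<Rightarrow>
   'x set \<Rightarrow> 'y set \<Rightarrow> real \<Rightarrow> (('y \<times> (real^'k)) \<times> 'x) set" where
  "sublevel_params g h X B c =
     {((b, a), x). x \<in> X \<and> (\<exists>y\<in>B. (\<forall>i. h i (x, y) + a $ i \<le> 0) \<and> g (x, y) + y \<bullet> b \<le> c)}"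

lemma sublevel_params_mono: "c \<le> c' \<Longrightarrow> sublevel_params g h X B c \<subseteq> sublevel_params g h X B c'"
  by (fastforce simp: sublevel_params_def)

text \<open>Projections of Borel sets need not be Borel, but projecting along the compact factor
  \<open>B\<close> preserves relative closedness. The result is a closed set intersected with the
  preimage of \<open>X\<close>.\<close>

lemma borel_sublevel_params:
  fixes g :: "'x::euclidean_space \<times> 'y::euclidean_space \<Rightarrow> real" and h :: "'k::finite \<Rightarrow> 'x \<times> 'y \<Rightarrow> real"
  assumes g: "continuous_on (X \<times> UNIV) g" and h: "\<And>i. continuous_on (X \<times> UNIV) (h i)"
    and X: "X \<in> sets borel" and B: "compact B"
  shows "sublevel_params g h X B c \<in> sets borel"
proof -
  define W :: "(('y \<times> (real^'k)) \<times> 'x) set" where "W = UNIV \<times> X"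
  define \<Psi> where "\<Psi> = (\<lambda>(y, ((b::'y, a::real^'k), x)). ((\<chi> i. h i (x, y) + a $ i), g (x, y) + y \<bullet> b))"
  define T :: "((real^'k) \<times> real) set" where "T = {v. \<forall>i. v $ i \<le> 0} \<times> {..c}"
  have "continuous_on (B \<times> W) (\<lambda>z. (snd (snd z), fst z))"
    by (intro continuous_intros)
  moreover have "(\<lambda>z. (snd (snd z), fst z)) ` (B \<times> W) \<subseteq> X \<times> UNIV"
    by (auto simp: W_def)
  ultimately have comp: "continuous_on (B \<times> W) (\<lambda>z. k (snd (snd z), fst z))"
    if "continuous_on (X \<times> UNIV) k" for k :: "'x \<times> 'y \<Rightarrow> real"
    using continuous_on_compose2[OF that] by blast
  have "continuous_on (B \<times> W) \<Psi>"
    unfolding \<Psi>_def case_prod_beta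
    by (intro continuous_intros comp g h)
  moreover have "closed T"
    unfolding T_def by (intro closed_Times closed_Collect_all closed_Collect_le continuous_intros)
  ultimately have "closedin (top_of_set (B \<times> W)) (B \<times> W \<inter> \<Psi> -` T)"
    by (rule continuous_closedin_preimage)
  from closedin_compact_projection[OF B this]
  have "closedin (top_of_set W) {p. \<exists>y. y \<in> B \<and> (y, p) \<in> B \<times> W \<inter> \<Psi> -` T}" .
  also have "{p. \<exists>y. y \<in> B \<and> (y, p) \<in> B \<times> W \<inter> \<Psi> -` T} = sublevel_params g h X B c"
    by (auto simp: sublevel_params_def W_def \<Psi>_def T_def Bex_def)
  finally obtain C where "closed C" "sublevel_params g h X B c = W \<inter> C"
    by (auto simp: closedin_closed)
  moreover have "W = snd -` X" by (auto simp: W_def)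
  moreover have "snd \<in> borel_measurable (borel :: (('y \<times> (real^'k)) \<times> 'x) measure)"
    by (intro borel_measurable_continuous_onI continuous_intros)
  ultimately have "sublevel_params g h X B c = snd -` X \<inter> C" "snd -` X \<in> sets (borel :: (('y \<times> (real^'k)) \<times> 'x) measure)"
    using measurable_sets_borel[OF _ X] by blast+
  then show ?thesis using \<open>closed C\<close> by auto
qed

definition uniform_shift :: "('y::real_vector \<times> (real^'k)) \<times> 'x::real_vector" where
  "uniform_shift = ((0, \<chi> i. 1), 0)"

lemma shift_in_sublevel_params_iff:
  "((b, a), x) + t *\<^sub>R uniform_shift \<in> sublevel_params g h X B c \<longleftrightarrow>
   x \<in> X \<and> (\<exists>y\<in>B. (\<forall>i. h i (x, y) + a $ i + t \<le> 0) \<and> g (x, y) + y \<bullet> b \<le> c)"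
  by (simp add: sublevel_params_def uniform_shift_def add.assoc)

text \<open>Rational \<open>s\<close> and \<open>q\<close> suffice because the minimum over \<open>B\<close> is monotone in the shift; they keep the
  set Borel.\<close>

definition noncalm_params ::
  "('x \<times> 'y::euclidean_space \<Rightarrow> real) \<Rightarrow> ('k::finite \<Rightarrow> 'x::euclidean_space \<times> 'y \<Rightarrow> real) \<Rightarrow>
   'x set \<Rightarrow> 'y set \<Rightarrow> (('y \<times> (real^'k)) \<times> 'x) set" where
  "noncalm_params g h X B =
     (\<Union>n::nat. sublevel_params g h X B n) \<inter>
     (\<Inter>M::nat. \<Union>s\<in>\<rat> \<inter> {0<..}. \<Union>q\<in>\<rat>.
        (\<lambda>p. p + (- s) *\<^sub>R uniform_shift) -` sublevel_params g h X B q
          - sublevel_params g h X B (q + M * s))"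

lemma noncalm_params_iff:
  "p \<in> noncalm_params g h X B \<longleftrightarrow> (\<exists>c. p \<in> sublevel_params g h X B c) \<and>
     (\<forall>M::nat. \<exists>s\<in>\<rat>. 0 < s \<and> (\<exists>q\<in>\<rat>. p + (- s) *\<^sub>R uniform_shift \<in> sublevel_params g h X B q \<and>
        p \<notin> sublevel_params g h X B (q + M * s)))"
proof -
  have "(\<exists>n::nat. p \<in> sublevel_params g h X B n) \<longleftrightarrow> (\<exists>c. p \<in> sublevel_params g h X B c)"
    by (meson in_mono real_arch_simple sublevel_params_mono)
  then show ?thesis unfolding noncalm_params_def by (simp add: Bex_def conj_assoc)
qed

text \<open>On a line in direction \<open>uniform_shift\<close>, the minimal value over
  \<open>B\<close> is a monotone function \<open>f\<close> of \<open>t\<close>. A bad point on the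
  line has left slopes of \<open>f\<close> above every bound, and such points form a null
  set.\<close>

lemma null_noncalm_params:
  fixes g :: "'x::euclidean_space \<times> 'y::euclidean_space \<Rightarrow> real" and h :: "'k::finite \<Rightarrow> 'x \<times> 'y \<Rightarrow> real"
  assumes g: "continuous_on (X \<times> UNIV) g" and h: "\<And>i. continuous_on (X \<times> UNIV) (h i)"
    and X: "X \<in> sets borel" and B: "compact B"
  shows "noncalm_params g h X B \<in> null_sets lborel"
proof (rule null_sets_lborel_if_negligible_lines)
  have "(\<lambda>p. p + (- s) *\<^sub>R uniform_shift) -` sublevel_params g h X B q \<in> sets borel" for s q
    by (rule measurable_sets_borel[OF _ borel_sublevel_params[OF assms]]) measurable
  then show "noncalm_params g h X B \<in> sets borel"
    unfolding noncalm_params_def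
    by (intro sets.Int sets.countable_INT'' sets.countable_UN'' sets.Diff
        countable_Int1 countable_rat borel_sublevel_params[OF assms]) auto
next
  fix p :: "('y \<times> (real^'k)) \<times> 'x"
  obtain b a x where p: "p = ((b, a), x)" by (metis prod.exhaust)
  show "negligible {t. p + t *\<^sub>R uniform_shift \<in> noncalm_params g h X B}"
  proof (cases "x \<in> X")
    case False
    then show ?thesis by (simp add: p noncalm_params_iff shift_in_sublevel_params_iff)
  next
    case True
    define \<phi> where "\<phi> y = g (x, y) + y \<bullet> b" for y
    have "continuous_on B (\<lambda>y. g (x, y))"
      by (rule continuous_on_compose2[OF g]) (use True in \<open>auto intro!: continuous_intros\<close>)
    then have "compact (\<phi> ` B)"
      unfolding \<phi>_def by (intro compact_continuous_image B continuous_intros)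
    then obtain C where C: "\<And>y. y \<in> B \<Longrightarrow> \<bar>\<phi> y\<bar> \<le> C"
      by (metis bounded_iff compact_imp_bounded image_eqI real_norm_def)
    define V where "V t = {\<phi> y | y. y \<in> B \<and> (\<forall>i. h i (x, y) + a $ i + t \<le> 0)}" for t
    \<comment> \<open>The cap \<open>\<bar>C\<bar>\<close> is the value assigned to infeasible
      \<open>t\<close>. It is at least every attained value, so \<open>f\<close> stays bounded and
      monotone.\<close>
    define f where "f t = Inf (insert \<bar>C\<bar> (V t))" for t
    have V: "- \<bar>C\<bar> \<le> r" if "r \<in> insert \<bar>C\<bar> (V t)" for r t
      using that C by (fastforce simp: V_def)
    have bdd: "bdd_below (insert \<bar>C\<bar> (V t))" for t
      by (rule bdd_belowI[OF V])
    have lower: "- \<bar>C\<bar> \<le> f t" for t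
      unfolding f_def by (rule cInf_greatest) (use V in auto)
    have upper: "f t \<le> \<bar>C\<bar>" for t
      unfolding f_def by (rule cInf_lower[OF _ bdd]) simp
    have "mono f"
    proof (rule monoI)
      fix t u :: real assume "t \<le> u"
      have "V u \<subseteq> V t"
      proof
        fix r assume "r \<in> V u"
        then obtain y where "r = \<phi> y" "y \<in> B" and y: "\<And>i. h i (x, y) + a $ i + u \<le> 0"
          unfolding V_def by blast
        moreover have "h i (x, y) + a $ i + t \<le> 0" for i using y[of i] \<open>t \<le> u\<close> by linarith
        ultimately show "r \<in> V t" unfolding V_def by blast
      qed
      then show "f t \<le> f u"
        unfolding f_def by (rule cInf_superset_mono[OF insert_not_empty bdd Set.insert_mono])
    qed
    have "{t. p + t *\<^sub>R uniform_shift \<in> noncalm_params g h X B}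
        \<subseteq> {t. \<forall>M::nat. \<exists>s>0. real M * s \<le> f t - f (t - s)}"
    proof (intro subsetI CollectI allI)
      fix t and M :: nat
      assume "t \<in> {t. p + t *\<^sub>R uniform_shift \<in> noncalm_params g h X B}"
      then have "p + t *\<^sub>R uniform_shift \<in> noncalm_params g h X B" by (rule CollectD)
      note nc = iffD1[OF noncalm_params_iff this]
      obtain c where c: "p + t *\<^sub>R uniform_shift \<in> sublevel_params g h X B c"
        using conjunct1[OF nc] ..
      obtain s q :: real where s: "0 < s"
        and q: "p + t *\<^sub>R uniform_shift + (- s) *\<^sub>R uniform_shift \<in> sublevel_params g h X B q"
        and nq: "p + t *\<^sub>R uniform_shift \<notin> sublevel_params g h X B (q + real M * s)"
        using spec[OF conjunct2[OF nc], of M] by auto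
      have "p + (t - s) *\<^sub>R uniform_shift \<in> sublevel_params g h X B q"
        using q by (simp add: algebra_simps)
      then obtain y where "y \<in> B" "\<forall>i. h i (x, y) + a $ i + (t - s) \<le> 0" "\<phi> y \<le> q"
        unfolding p shift_in_sublevel_params_iff \<phi>_def by blast
      then have "f (t - s) \<le> q"
        unfolding f_def by (intro order_trans[OF cInf_lower[OF _ bdd]]) (auto simp: V_def)
      moreover have "q + M * s \<le> f t"
        unfolding f_def
      proof (rule cInf_greatest)
        fix r assume "r \<in> insert \<bar>C\<bar> (V t)"
        moreover have above: "q + M * s \<le> r" if "r \<in> V t" for r
          using nq that True unfolding p shift_in_sublevel_params_iff V_def \<phi>_def by force
        \<comment> \<open>Handles the cap: a bad point lies in some sublevel set, so
          \<open>V t\<close> is nonempty and the lower bound for its members passes on to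
          \<open>\<bar>C\<bar>\<close>.\<close>
        moreover have "\<exists>r\<in>V t. r \<le> \<bar>C\<bar>"
          using c C unfolding p shift_in_sublevel_params_iff V_def by fastforce
        ultimately show "q + M * s \<le> r" by force
      qed simp
      ultimately show "\<exists>s>0. real M * s \<le> f t - f (t - s)" using s by (intro exI[of _ s]) simp
    qed
    then show ?thesis
      by (rule negligible_subset[OF negligible_mono_infinite_left_slope[OF \<open>mono f\<close> lower upper]])
  qed
qed

text \<open>Feasibility of \<open>y\<close> puts the parameter in some sublevel set, so avoiding
  \<open>noncalm_params\<close> yields one \<open>M\<close> for all rational \<open>s\<close> and
  \<open>q\<close>. Density extends the inequality to real values.\<close>

lemma calm_at_if_not_noncalm_params:
  assumes nc: "((b, a), x) \<notin> noncalm_params g h X B"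
    and x: "x \<in> X" and y: "y \<in> interior B" and feas: "\<And>i. h i (x, y) + a $ i \<le> 0"
    and min: "\<And>z. z \<in> B \<Longrightarrow> (\<And>i. h i (x, z) + a $ i \<le> 0) \<Longrightarrow> g (x, y) + y \<bullet> b \<le> g (x, z) + z \<bullet> b"
  shows "\<exists>M. calm_at (\<lambda>z. g (x, z) + z \<bullet> b) (\<lambda>i z. h i (x, z) + a $ i) y M"
proof -
  define \<phi> where "\<phi> z = g (x, z) + z \<bullet> b" for z
  have sub: "((b, a), x) \<in> sublevel_params g h X B q \<longleftrightarrow>
      x \<in> X \<and> (\<exists>y\<in>B. (\<forall>i. h i (x, y) + a $ i \<le> 0) \<and> \<phi> y \<le> q)" for q
    by (simp add: sublevel_params_def \<phi>_def)
  have "((b, a), x) \<in> sublevel_params g h X B (\<phi> y)"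
    using x y feas interior_subset by (auto simp: sub)
  then obtain M :: nat where M: "\<And>(s::real) (q::real). s \<in> \<rat> \<Longrightarrow> 0 < s \<Longrightarrow> q \<in> \<rat> \<Longrightarrow>
      ((b, a), x) + (- s) *\<^sub>R uniform_shift \<in> sublevel_params g h X B q \<Longrightarrow>
      ((b, a), x) \<in> sublevel_params g h X B (q + M * s)"
    using nc unfolding noncalm_params_iff by blast
  have key: "\<phi> y \<le> \<phi> z + M * s" if z: "z \<in> B" and "0 \<le> s" and s: "\<And>i. h i (x, z) + a $ i \<le> s" for z and s :: real
  proof (rule field_le_epsilon)
    fix e :: real assume "e > 0"
    obtain q where q: "q \<in> \<rat>" "\<phi> z < q" "q < \<phi> z + e / 2"
      using Rats_dense_in_real[of "\<phi> z" "\<phi> z + e / 2"] \<open>e > 0\<close> by auto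
    \<comment> \<open>Half of \<open>e\<close> is spent on \<open>q\<close>, the other half on
      \<open>M * (s' - s)\<close>; the added 1 keeps the divisor positive when
      \<open>M = 0\<close>.\<close>
    obtain s' where s': "s' \<in> \<rat>" "s < s'" "s' < s + e / (2 * (real M + 1))"
      using Rats_dense_in_real[of s "s + e / (2 * (real M + 1))"] \<open>e > 0\<close> by auto
    have "((b, a), x) + (- s') *\<^sub>R uniform_shift \<in> sublevel_params g h X B q"
      unfolding shift_in_sublevel_params_iff
    proof (intro conjI bexI[OF _ z] allI x)
      show "h i (x, z) + a $ i + - s' \<le> 0" for i using s[of i] s' by simp
      show "g (x, z) + z \<bullet> b \<le> q" using q by (simp add: \<phi>_def)
    qed
    then have "((b, a), x) \<in> sublevel_params g h X B (q + M * s')"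
      using M s' q \<open>0 \<le> s\<close> by auto
    then obtain z' where "z' \<in> B" "\<And>i. h i (x, z') + a $ i \<le> 0" "\<phi> z' \<le> q + M * s'"
      unfolding sub by blast
    then have "\<phi> y \<le> q + M * s'" using min[of z'] unfolding \<phi>_def by force
    moreover have "M * s' \<le> M * (s + e / (2 * (real M + 1)))"
      using s' by (intro mult_left_mono) auto
    moreover have "M * (s + e / (2 * (real M + 1))) \<le> M * s + e / 2"
      using \<open>e > 0\<close> by (simp add: field_simps)
    ultimately show "\<phi> y \<le> \<phi> z + M * s + e" using q by linarith
  qed
  obtain r where "r > 0" "ball y r \<subseteq> B" using y by (auto simp: mem_interior)
  have "calm_at \<phi> (\<lambda>i z. h i (x, z) + a $ i) y M"
    unfolding calm_at_def
  proof (intro conjI exI[of _ r] ballI allI impI)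
    fix z and s :: real
    assume "z \<in> ball y r" "0 \<le> s" "\<forall>i. h i (x, z) + a $ i \<le> s"
    then show "\<phi> y \<le> \<phi> z + M * s" using key \<open>ball y r \<subseteq> B\<close> by blast
  qed (use \<open>r > 0\<close> in simp_all)
  then show ?thesis unfolding \<phi>_def by blast
qed

section \<open>The KKT map\<close>

lemma has_derivative_vec_lambda:
  fixes f :: "'a::euclidean_space \<Rightarrow> 'i::finite \<Rightarrow> real"
  assumes "\<And>i. ((\<lambda>x. f x i) has_derivative (\<lambda>h. f' h i)) F"
  shows "((\<lambda>x. \<chi> i. f x i) has_derivative (\<lambda>h. \<chi> i. f' h i)) F"
proof -
  have "(\<lambda>x. \<chi> i. k x i) = (\<lambda>x. \<Sum>i\<in>UNIV. k x i *\<^sub>R axis i 1)" for k :: "'a \<Rightarrow> 'i \<Rightarrow> real"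
    by (simp add: fun_eq_iff vec_eq_iff axis_def if_distrib[of "\<lambda>x. _ * x"] cong: if_cong)
  then show ?thesis using assms
    by (auto intro!: derivative_eq_intros)
qed

section \<open>Gradients in y of functions of (x, y)\<close>

lemma gradient_eqI: "GDERIV f y :> D \<Longrightarrow> gradient f y = D"
  unfolding gradient_def
proof (rule the_equality)
  fix D' assume "GDERIV f y :> D" "GDERIV f y :> D'"
  then have "(\<lambda>h. h \<bullet> D) = (\<lambda>h. h \<bullet> D')"
    unfolding gderiv_def by (rule has_derivative_unique)
  then have "h \<bullet> D = h \<bullet> D'" for h by (rule fun_cong)
  then show "D' = D" by (metis vector_eq_ldot)
qed

text \<open>Kept as a function of the pair, since the KKT map is differentiated in x as
  well.\<close>

definition partial_gradient :: "('x::euclidean_space \<times> (real^'m) \<Rightarrow> real) \<Rightarrow> 'x \<times> (real^'m) \<Rightarrow> real^'m" where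
  "partial_gradient f p = (\<chi> j. frechet_derivative f (at p) (0, axis j 1))"

lemma inner_partial_gradient:
  assumes "f differentiable at p"
  shows "frechet_derivative f (at p) (0, d) = d \<bullet> partial_gradient f p"
proof -
  have lin: "linear (\<lambda>d. frechet_derivative f (at p) (0, d))"
    using linear_compose[of "\<lambda>d. (0, d)" "frechet_derivative f (at p)"]
      linear_frechet_derivative[OF assms] by (simp add: o_def linear_iff)
  have "frechet_derivative f (at p) (0, d) = frechet_derivative f (at p) (0, \<Sum>j\<in>UNIV. d $ j *\<^sub>R axis j 1)"
    using basis_expansion[of d] by (simp add: scalar_mult_eq_scaleR)
  also have "\<dots> = (\<Sum>j\<in>UNIV. d $ j *\<^sub>R frechet_derivative f (at p) (0, axis j 1))"
    by (simp only: linear_sum[OF lin] linear_cmul[OF lin])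
  finally show ?thesis by (simp add: partial_gradient_def inner_vec_def)
qed

lemma has_derivative_slice:
  assumes "(f has_derivative f') (at (x, y))"
  shows "((\<lambda>z. f (x, z)) has_derivative (\<lambda>d. f' (0, d))) (at y)"
proof -
  have "((\<lambda>z. (x, z)) has_derivative (\<lambda>d. (0, d))) (at y)"
    by (auto intro!: derivative_eq_intros)
  from has_derivative_compose[OF this assms] show ?thesis .
qed

lemma GDERIV_slice:
  assumes "f differentiable at (x, y)"
  shows "GDERIV (\<lambda>z. f (x, z)) y :> partial_gradient f (x, y)"
  using has_derivative_slice[OF frechet_derivative_works[THEN iffD1, OF assms]]
  unfolding gderiv_def inner_partial_gradient[OF assms] .

lemma C_infinity_on_differentiable:
  assumes "C_infinity_on f U" "p \<in> U"
  shows "f differentiable at p"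
proof -
  have "Ck_on (Suc 0) f U" using assms(1) unfolding C_infinity_on_def by blast
  then show ?thesis using assms(2) by simp
qed

lemma C_infinity_on_partial_gradient_differentiable:
  assumes "C_infinity_on f U" "p \<in> U"
  shows "partial_gradient f differentiable at p"
proof -
  have "Ck_on (Suc (Suc 0)) f U" using assms(1) unfolding C_infinity_on_def by blast
  then have "(\<lambda>q. frechet_derivative f (at q) v) differentiable at p" for v
    using assms(2) unfolding Ck_on.simps by blast
  then have "((\<lambda>q. frechet_derivative f (at q) v) has_derivative
      frechet_derivative (\<lambda>q. frechet_derivative f (at q) v) (at p)) (at p)" for v
    by (rule frechet_derivative_works[THEN iffD1])
  then have "((\<lambda>q. \<chi> j. frechet_derivative f (at q) (0, axis j 1)) has_derivative
     (\<lambda>h. \<chi> j. frechet_derivative (\<lambda>q. frechet_derivative f (at q) (0, axis j 1)) (at p) h)) (at p)"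
    by (intro has_derivative_vec_lambda)
  then have "(partial_gradient f has_derivative
     (\<lambda>h. \<chi> j. frechet_derivative (\<lambda>q. frechet_derivative f (at q) (0, axis j 1)) (at p) h)) (at p)"
    unfolding partial_gradient_def[abs_def] .
  then show ?thesis by (rule differentiableI)
qed

text \<open>Off \<open>I\<close> the coordinates of \<mu> store those of \<open>a\<close>, so that
  source and target have the same dimension. Carrying \<open>x\<close> along lets an onto derivative
  be solved with the increment of \<open>x\<close> held at 0.\<close>

definition kkt_map ::
  "('x::euclidean_space \<times> (real^'m) \<Rightarrow> real) \<Rightarrow> ('k::finite \<Rightarrow> 'x \<times> (real^'m) \<Rightarrow> real) \<Rightarrow> 'k set \<Rightarrow>
   ('x \<times> (real^'m)) \<times> (real^'k) \<Rightarrow> ((real^'m) \<times> (real^'k)) \<times> 'x" where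
  "kkt_map g h I = (\<lambda>(p, \<mu>).
     ((- partial_gradient g p - (\<Sum>i\<in>I. \<mu> $ i *\<^sub>R partial_gradient (h i) p),
       \<chi> i. if i \<in> I then - h i p else \<mu> $ i), fst p))"

definition kkt_map_deriv ::
  "('x::euclidean_space \<times> (real^'m) \<Rightarrow> real) \<Rightarrow> ('k::finite \<Rightarrow> 'x \<times> (real^'m) \<Rightarrow> real) \<Rightarrow> 'k set \<Rightarrow>
   ('x \<times> (real^'m)) \<times> (real^'k) \<Rightarrow> ('x \<times> (real^'m)) \<times> (real^'k) \<Rightarrow> ((real^'m) \<times> (real^'k)) \<times> 'x" where
  "kkt_map_deriv g h I = (\<lambda>(p, \<mu>) (q, \<nu>).
     ((- frechet_derivative (partial_gradient g) (at p) q
        - (\<Sum>i\<in>I. \<mu> $ i *\<^sub>R frechet_derivative (partial_gradient (h i)) (at p) q + \<nu> $ i *\<^sub>R partial_gradient (h i) p),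
       \<chi> i. if i \<in> I then - frechet_derivative (h i) (at p) q else \<nu> $ i), fst q))"

lemma has_derivative_kkt_map:
  fixes g :: "'x::euclidean_space \<times> (real^'m) \<Rightarrow> real" and h :: "'k::finite \<Rightarrow> 'x \<times> (real^'m) \<Rightarrow> real"
  assumes g: "C_infinity_on g U" and h: "\<And>i. C_infinity_on (h i) U" and p: "fst w \<in> U"
  shows "(kkt_map g h I has_derivative kkt_map_deriv g h I w) (at w)"
proof -
  have fst: "(fst has_derivative fst) (at w)"
    by (auto intro!: derivative_eq_intros)
  have D: "((\<lambda>w. k (fst w)) has_derivative (\<lambda>q. frechet_derivative k (at (fst w)) (fst q))) (at w)"
    if "k differentiable at (fst w)" for k :: "'x \<times> (real^'m) \<Rightarrow> 'c::real_normed_vector"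
    by (rule has_derivative_compose[OF fst frechet_derivative_works[THEN iffD1, OF that]])
  note dg = D[OF C_infinity_on_partial_gradient_differentiable[OF g p]]
  note dh = D[OF C_infinity_on_partial_gradient_differentiable[OF h p]]
  note h0 = D[OF C_infinity_on_differentiable[OF h p]]
  have nth: "((\<lambda>w :: ('x \<times> (real^'m)) \<times> (real^'k). snd w $ i) has_derivative (\<lambda>q. snd q $ i)) (at w)" for i
    by (rule bounded_linear.has_derivative[OF bounded_linear_vec_nth]) (auto intro!: derivative_eq_intros)
  have 1: "((\<lambda>w. - partial_gradient g (fst w) - (\<Sum>i\<in>I. snd w $ i *\<^sub>R partial_gradient (h i) (fst w)))
     has_derivative (\<lambda>q. - frechet_derivative (partial_gradient g) (at (fst w)) (fst q)
        - (\<Sum>i\<in>I. snd w $ i *\<^sub>R frechet_derivative (partial_gradient (h i)) (at (fst w)) (fst q)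
            + snd q $ i *\<^sub>R partial_gradient (h i) (fst w)))) (at w)"
    by (intro has_derivative_diff has_derivative_minus has_derivative_sum has_derivative_scaleR dg dh nth)
  have 2: "((\<lambda>w. \<chi> i. if i \<in> I then - h i (fst w) else snd w $ i)
     has_derivative (\<lambda>q. \<chi> i. if i \<in> I then - frechet_derivative (h i) (at (fst w)) (fst q) else snd q $ i)) (at w)"
  proof (rule has_derivative_vec_lambda)
    show "((\<lambda>w. if i \<in> I then - h i (fst w) else snd w $ i) has_derivative
        (\<lambda>q. if i \<in> I then - frechet_derivative (h i) (at (fst w)) (fst q) else snd q $ i)) (at w)" for i
      by (cases "i \<in> I") (simp_all add: has_derivative_minus h0 nth)
  qed
  have 3: "((\<lambda>w :: ('x \<times> (real^'m)) \<times> (real^'k). fst (fst w)) has_derivative (\<lambda>q. fst (fst q))) (at w)"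
    by (auto intro!: derivative_eq_intros)
  show ?thesis
    using has_derivative_Pair[OF has_derivative_Pair[OF 1 2] 3]
    unfolding kkt_map_def kkt_map_deriv_def case_prod_beta .
qed

text \<open>The first family consists of critical values. The second removes vanishing multipliers
  for \<open>i \<in> I\<close>; for other \<open>i\<close> it removes part of the hyperplane on
  which \<open>a\<close> has a zero coordinate.\<close>

definition kkt_exceptional ::
  "('x::euclidean_space \<times> (real^'m) \<Rightarrow> real) \<Rightarrow> ('k::finite \<Rightarrow> 'x \<times> (real^'m) \<Rightarrow> real) \<Rightarrow>
   ('x \<times> (real^'m)) set \<Rightarrow> (((real^'m) \<times> (real^'k)) \<times> 'x) set" where
  "kkt_exceptional g h U =
     (\<Union>I. kkt_map g h I ` {w. fst w \<in> U \<and> \<not> surj (kkt_map_deriv g h I w)}) \<union>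
     (\<Union>I. \<Union>i. kkt_map g h I ` {w. fst w \<in> U \<and> snd w $ i = 0})"

text \<open>Sard's theorem covers the critical values. The rest are differentiable images of subsets
  of hyperplanes in equal dimensions, and there are finitely many \<open>I\<close> and
  \<open>i\<close>.\<close>

lemma negligible_kkt_exceptional:
  fixes g :: "'x::euclidean_space \<times> (real^'m) \<Rightarrow> real" and h :: "'k::finite \<Rightarrow> 'x \<times> (real^'m) \<Rightarrow> real"
  assumes g: "C_infinity_on g U" and h: "\<And>i. C_infinity_on (h i) U"
  shows "negligible (kkt_exceptional g h U)"
proof -
  have dim: "DIM(('x \<times> (real^'m)) \<times> (real^'k)) = DIM(((real^'m) \<times> (real^'k)) \<times> 'x)"
    by simp
  have diff: "kkt_map g h I differentiable at w" if "fst w \<in> U" for I w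
    by (rule differentiableI[OF has_derivative_kkt_map[OF g h that]])
  have "negligible (kkt_map g h I ` {w. fst w \<in> U \<and> \<not> surj (kkt_map_deriv g h I w)})" for I
    by (rule sard_equal_dimensions[OF dim, where f'="kkt_map_deriv g h I"])
      (auto intro: has_derivative_at_withinI has_derivative_kkt_map[OF g h])
  moreover have "negligible (kkt_map g h I ` {w. fst w \<in> U \<and> snd w $ i = 0})" for I i
  proof (rule negligible_differentiable_image_negligible[OF eq_refl[OF dim]])
    have "{w :: ('x \<times> (real^'m)) \<times> (real^'k). snd w $ i = 0} = {w. ((0, 0), axis i 1) \<bullet> w = 0}"
      by (auto simp: inner_prod_def inner_axis')
    moreover have "negligible {w :: ('x \<times> (real^'m)) \<times> (real^'k). ((0, 0), axis i 1) \<bullet> w = 0}"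
      by (rule negligible_hyperplane) (simp add: prod_eq_iff axis_eq_0_iff)
    ultimately show "negligible {w :: ('x \<times> (real^'m)) \<times> (real^'k). fst w \<in> U \<and> snd w $ i = 0}"
      by (auto intro: negligible_subset)
    show "kkt_map g h I differentiable_on {w. fst w \<in> U \<and> snd w $ i = 0}"
      unfolding differentiable_on_def using diff by (auto intro: differentiable_at_withinI)
  qed
  ultimately show ?thesis
    unfolding kkt_exceptional_def by (intro negligible_Un negligible_Union) auto
qed

section \<open>Second-order sufficient conditions\<close>

lemma linear_term_zero_if_quadratic_nonneg:
  fixes \<beta> \<gamma> :: real
  assumes "\<And>t. 0 \<le> t * \<beta> + t\<^sup>2 * \<gamma>"
  shows "\<beta> = 0"
proof (rule ccontr)
  assume "\<beta> \<noteq> 0"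
  define k where "k = \<bar>\<gamma>\<bar> + 1"
  have "k > 0" by (simp add: k_def)
  \<comment> \<open>This \<open>t\<close> makes the expression at most
    \<open>- ((\<beta> / k)\<^sup>2)\<close>.\<close>
  define t where "t = - \<beta> / k"
  have "t * \<beta> + t\<^sup>2 * \<gamma> \<le> t * \<beta> + t\<^sup>2 * (k - 1)"
    by (intro add_left_mono mult_left_mono) (auto simp: k_def)
  also have "\<dots> = - ((\<beta> / k)\<^sup>2)"
    using \<open>k > 0\<close> by (simp add: t_def field_simps power2_eq_square)
  also have "\<dots> < 0" using \<open>\<beta> \<noteq> 0\<close> \<open>k > 0\<close> by simp
  finally show False using assms[of t] by simp
qed

text \<open>A null vector of a nonnegative quadratic form minimises it on \<open>K\<close>, so the
  linear term of the form at \<open>d + t e\<close> vanishes.\<close>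

lemma inner_zero_if_nonneg_on_subspace:
  fixes H :: "'a::real_inner \<Rightarrow> 'a"
  assumes "linear H" "\<And>v w. v \<bullet> H w = w \<bullet> H v" "subspace K"
    and "\<And>d. d \<in> K \<Longrightarrow> 0 \<le> d \<bullet> H d" "d \<in> K" "d \<bullet> H d = 0" "e \<in> K"
  shows "d \<bullet> H e = 0"
proof -
  have "0 \<le> t * (2 * (d \<bullet> H e)) + t\<^sup>2 * (e \<bullet> H e)" for t
  proof -
    have "d + t *\<^sub>R e \<in> K" using assms by (simp add: subspace_add subspace_scale)
    then have "0 \<le> (d + t *\<^sub>R e) \<bullet> H (d + t *\<^sub>R e)" by (rule assms(4))
    also have "\<dots> = t * (2 * (d \<bullet> H e)) + t\<^sup>2 * (e \<bullet> H e)"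
      using assms(6) assms(2)[of e d]
      by (simp add: linear_add[OF assms(1)] linear_cmul[OF assms(1)] inner_add_left inner_add_right
          power2_eq_square algebra_simps)
    finally show ?thesis .
  qed
  then show ?thesis using linear_term_zero_if_quadratic_nonneg by fastforce
qed

lemma sosc_at_if_calm_and_not_exceptional:
  fixes g :: "(real^'n) \<times> (real^'m) \<Rightarrow> real" and h :: "'k::finite \<Rightarrow> (real^'n) \<times> (real^'m) \<Rightarrow> real"
  assumes g: "C_infinity_on g U" and h: "\<And>i. C_infinity_on (h i) U"
    and xU: "\<And>z. (x, z) \<in> U"
    and reg: "((b, a), x) \<notin> kkt_exceptional g h U"
    and feas: "\<And>i. h i (x, y) + a $ i \<le> 0"
    and calm: "calm_at (\<lambda>z. g (x, z) + z \<bullet> b) (\<lambda>i z. h i (x, z) + a $ i) y M"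
  shows "sosc_at (perturbed_objective g b) (perturbed_constraint h a) x y"
proof -
  define \<phi> where "\<phi> = (\<lambda>z. g (x, z) + z \<bullet> b)"
  define c where "c = (\<lambda>i z. h i (x, z) + a $ i)"
  define u where "u = (\<lambda>z. partial_gradient g (x, z) + b)"
  define v where "v = (\<lambda>i z. partial_gradient (h i) (x, z))"
  define u' where "u' = (\<lambda>d. frechet_derivative (partial_gradient g) (at (x, y)) (0, d))"
  define v' where "v' = (\<lambda>i d. frechet_derivative (partial_gradient (h i)) (at (x, y)) (0, d))"
  define I where "I = {i. c i y = 0}"
  have G: "perturbed_objective g b (x, z) = \<phi> z" for z
    by (simp add: perturbed_objective_def \<phi>_def)
  have C: "perturbed_constraint h a i (x, z) = c i z" for i z
    by (simp add: perturbed_constraint_def c_def)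
  note slice = GDERIV_slice[OF C_infinity_on_differentiable]
  have \<phi>: "GDERIV \<phi> z :> u z" for z
    unfolding \<phi>_def u_def
    using GDERIV_add[OF slice[OF g xU], of "\<lambda>z. z \<bullet> b" z b]
    by (simp add: gderiv_def has_derivative_ident has_derivative_inner_left)
  have c: "GDERIV (c i) z :> v i z" for i z
    unfolding c_def v_def using GDERIV_add[OF slice[OF h xU] GDERIV_const] by simp
  note pslice = has_derivative_slice[OF frechet_derivative_works[THEN iffD1,
        OF C_infinity_on_partial_gradient_differentiable]]
  have u: "(u has_derivative u') (at y)"
    unfolding u_def u'_def
    using has_derivative_add[OF pslice[OF g xU] has_derivative_const] by simp
  have v: "(v i has_derivative v' i) (at y)" for i
    unfolding v_def v'_def by (rule pslice[OF h xU])
  have feas': "c i y \<le> 0" for i using feas by (simp add: c_def)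
  have kkt: "kkt_pair (perturbed_objective g b) (perturbed_constraint h a) x y l \<longleftrightarrow>
      u y + (\<Sum>i\<in>UNIV. l $ i *\<^sub>R v i y) = 0 \<and> (\<forall>i. c i y \<le> 0 \<and> l $ i \<ge> 0 \<and> l $ i * c i y = 0)" for l
    by (simp add: kkt_pair_def G C gradient_eqI[OF \<phi>] gradient_eqI[OF c])
  have calm': "calm_at \<phi> c y M" using calm by (simp add: \<phi>_def c_def)
  obtain l0 where "kkt_pair (perturbed_objective g b) (perturbed_constraint h a) x y l0"
    using calm_at_multiplier[OF calm' \<phi> c feas'] feas' kkt by metis
  moreover have "sosc_at_pair (perturbed_objective g b) (perturbed_constraint h a) x y l"
    if "kkt_pair (perturbed_objective g b) (perturbed_constraint h a) x y l" for l
  proof -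
    have stat: "u y + (\<Sum>i\<in>UNIV. l $ i *\<^sub>R v i y) = 0" and lnn: "l $ i \<ge> 0"
      and compl: "l $ i * c i y = 0" for i
      using that unfolding kkt by blast+
    have off: "l $ i = 0" if "i \<notin> I" for i using compl[of i] that by (simp add: I_def)
    have sumI: "(\<Sum>i\<in>I. l $ i *\<^sub>R w i) = (\<Sum>i\<in>UNIV. l $ i *\<^sub>R w i)" for w :: "'k \<Rightarrow> real^'m"
      by (rule sum.mono_neutral_left) (auto simp: off)
    \<comment> \<open>The preimage of the given data: multipliers on the active set, and off it the
      entries of \<open>a\<close> that the KKT map copies.\<close>
    define \<mu> where "\<mu> = (\<chi> i. if i \<in> I then l $ i else a $ i)"
    have sum\<mu>: "(\<Sum>i\<in>I. \<mu> $ i *\<^sub>R w i) = (\<Sum>i\<in>UNIV. l $ i *\<^sub>R w i)" for w :: "'k \<Rightarrow> real^'m"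
      unfolding sumI[symmetric] by (rule sum.cong) (auto simp: \<mu>_def)
    have img: "((b, a), x) = kkt_map g h I ((x, y), \<mu>)"
    proof -
      have "b = - partial_gradient g (x, y) - (\<Sum>i\<in>I. \<mu> $ i *\<^sub>R partial_gradient (h i) (x, y))"
        using stat sum\<mu>[of "\<lambda>i. partial_gradient (h i) (x, y)"]
        by (simp add: u_def v_def algebra_simps eq_neg_iff_add_eq_0)
      moreover have "a = (\<chi> i. if i \<in> I then - h i (x, y) else \<mu> $ i)"
        by (auto simp: vec_eq_iff I_def c_def \<mu>_def)
      ultimately show ?thesis by (simp add: kkt_map_def)
    qed
    have surj: "surj (kkt_map_deriv g h I ((x, y), \<mu>))"
    proof (rule ccontr)
      assume "\<not> surj (kkt_map_deriv g h I ((x, y), \<mu>))"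
      then have "((b, a), x) \<in> kkt_map g h I ` {w. fst w \<in> U \<and> \<not> surj (kkt_map_deriv g h I w)}"
        using xU unfolding img by (intro imageI) simp
      then show False using reg unfolding kkt_exceptional_def by blast
    qed
    have strict: "l $ i > 0" if "i \<in> I" for i
    proof -
      have "\<mu> $ i \<noteq> 0"
      proof
        assume "\<mu> $ i = 0"
        then have "((b, a), x) \<in> kkt_map g h I ` {w. fst w \<in> U \<and> snd w $ i = 0}"
          using xU unfolding img by (intro imageI) simp
        then show False using reg unfolding kkt_exceptional_def by blast
      qed
      then show ?thesis using that lnn[of i] by (simp add: \<mu>_def)
    qed
    have hv: "frechet_derivative (h i) (at (x, y)) (0, d) = d \<bullet> v i y" for i d
      unfolding v_def by (rule inner_partial_gradient[OF C_infinity_on_differentiable[OF h xU]])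
    \<comment> \<open>The bordered linear system in \<open>d\<close> and \<nu>, solvable for every
      right-hand side. Free \<alpha> gives independence of the active gradients; free \<beta> gives
      nondegeneracy on \<open>K\<close>.\<close>
    have solve: "\<exists>d \<nu>. - u' d - (\<Sum>i\<in>UNIV. l $ i *\<^sub>R v' i d) - (\<Sum>i\<in>I. \<nu> $ i *\<^sub>R v i y) = \<beta> \<and>
        (\<forall>i\<in>I. v i y \<bullet> d = - \<alpha> i)" for \<beta> \<alpha>
    proof -
      obtain w where w: "kkt_map_deriv g h I ((x, y), \<mu>) w = ((\<beta>, \<chi> i. \<alpha> i), 0)"
        using surj by (metis surjD)
      obtain \<xi> d \<nu> where wd: "w = ((\<xi>, d), \<nu>)" by (metis prod.exhaust)
      have "\<xi> = 0" using w by (simp add: wd kkt_map_deriv_def)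
      have "- u' d - (\<Sum>i\<in>I. \<mu> $ i *\<^sub>R v' i d + \<nu> $ i *\<^sub>R v i y) = \<beta>"
        using w \<open>\<xi> = 0\<close> by (simp add: wd kkt_map_deriv_def u'_def v'_def v_def)
      then have "- u' d - (\<Sum>i\<in>UNIV. l $ i *\<^sub>R v' i d) - (\<Sum>i\<in>I. \<nu> $ i *\<^sub>R v i y) = \<beta>"
        by (simp add: sum.distrib sum\<mu> algebra_simps)
      moreover have "v i y \<bullet> d = - \<alpha> i" if "i \<in> I" for i
      proof -
        have "(\<chi> i. if i \<in> I then - frechet_derivative (h i) (at (x, y)) (0, d) else \<nu> $ i) = (\<chi> i. \<alpha> i)"
          using w \<open>\<xi> = 0\<close> by (simp add: wd kkt_map_deriv_def)
        from arg_cong[OF this, of "\<lambda>v. v $ i"]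
        have "- frechet_derivative (h i) (at (x, y)) (0, d) = \<alpha> i"
          using that by simp
        then show ?thesis by (simp add: hv inner_commute)
      qed
      ultimately show ?thesis by blast
    qed
    define L where "L = (\<lambda>z. \<phi> z + (\<Sum>i\<in>UNIV. l $ i * c i z))"
    define \<Gamma> where "\<Gamma> = (\<lambda>z. u z + (\<Sum>i\<in>UNIV. l $ i *\<^sub>R v i z))"
    define H where "H = (\<lambda>d. u' d + (\<Sum>i\<in>UNIV. l $ i *\<^sub>R v' i d))"
    have L: "GDERIV L z :> \<Gamma> z" for z
    proof -
      have "((\<lambda>z. \<phi> z + (\<Sum>i\<in>UNIV. l $ i * c i z)) has_derivative
          (\<lambda>d. d \<bullet> u z + (\<Sum>i\<in>UNIV. l $ i * (d \<bullet> v i z)))) (at z)"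
        using \<phi> c unfolding gderiv_def
        by (intro has_derivative_add has_derivative_sum has_derivative_mult_right)
      then show ?thesis
        by (simp add: gderiv_def L_def \<Gamma>_def inner_add_right inner_sum_right)
    qed
    have H: "(\<Gamma> has_derivative H) (at y)"
      unfolding \<Gamma>_def H_def
      by (intro has_derivative_add has_derivative_sum has_derivative_scaleR_right u v)
    have lagr: "lagrangian (perturbed_objective g b) (perturbed_constraint h a) x z l = L z" for z
      by (simp add: lagrangian_def G C L_def)
    have "gradient L = \<Gamma>" using gradient_eqI[OF L] by blast
    then have hess: "hessian (\<lambda>z. lagrangian (perturbed_objective g b) (perturbed_constraint h a) x z l) y *v d = H d" for d
      unfolding lagr hessian_def jacobian_def frechet_derivative_at[OF H, symmetric]
      using has_derivative_linear[OF H] frechet_derivative_at[OF H] by (simp add: matrix_works)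
    define K where "K = {d. \<forall>i\<in>I. v i y \<bullet> d = 0}"
    have "subspace K" unfolding subspace_def K_def by (simp add: inner_add_right)
    have nonneg: "0 \<le> d \<bullet> H d" if "d \<in> K" for d
      unfolding H_def
    proof (rule calm_at_second_order_necessary[OF calm' \<phi> u c v feas' compl stat])
      fix \<alpha> :: "'k \<Rightarrow> real"
      show "\<exists>w. \<forall>i. c i y = 0 \<longrightarrow> v i y \<bullet> w = \<alpha> i"
        using solve[of 0 "\<lambda>i. - \<alpha> i"] by (auto simp: I_def)
      show "v i y \<bullet> d = 0" if "c i y = 0" for i
        using \<open>d \<in> K\<close> that by (simp add: K_def I_def)
    qed
    show ?thesis
      unfolding sosc_at_pair_def
    proof (intro ballI impI)
      fix d assume d: "d \<in> critical_cone (perturbed_constraint h a) x y l" "d \<noteq> 0"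
      have "d \<in> K"
        using d(1) strict by (auto simp: critical_cone_def K_def I_def C gradient_eqI[OF c])
      have "d \<bullet> H d \<noteq> 0"
      proof
        assume zero: "d \<bullet> H d = 0"
        \<comment> \<open>Taking \<open>d\<close> itself as the right-hand side writes it as
          \<open>- H e\<close> minus a combination of active gradients. Both terms are orthogonal to
          \<open>d\<close>, which forces \<open>d = 0\<close>.\<close>
        obtain e \<nu> where e: "- u' e - (\<Sum>i\<in>UNIV. l $ i *\<^sub>R v' i e) - (\<Sum>i\<in>I. \<nu> $ i *\<^sub>R v i y) = d"
          and "\<forall>i\<in>I. v i y \<bullet> e = - 0"
          using solve[of d "\<lambda>_. 0"] by blast
        then have "e \<in> K" by (simp add: K_def)
        have "d \<bullet> H e = 0"
          by (rule inner_zero_if_nonneg_on_subspace[OF has_derivative_linear[OF H]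
                derivative_of_gradient_symmetric[OF L H] \<open>subspace K\<close> _ \<open>d \<in> K\<close> zero \<open>e \<in> K\<close>])
            (rule nonneg)
        moreover have "d \<bullet> (\<Sum>i\<in>I. \<nu> $ i *\<^sub>R v i y) = 0"
          using \<open>d \<in> K\<close> by (simp add: K_def inner_sum_right inner_commute)
        moreover have "d = - H e - (\<Sum>i\<in>I. \<nu> $ i *\<^sub>R v i y)"
          using e by (simp add: H_def)
        ultimately have "d \<bullet> d = 0" by (metis inner_diff_right inner_minus_right diff_zero minus_zero)
        then show False using d(2) by simp
      qed
      then have "0 < d \<bullet> H d" using nonneg[OF \<open>d \<in> K\<close>] by simp
      then show "0 < d \<bullet> (hessian (\<lambda>z. lagrangian (perturbed_objective g b) (perturbed_constraint h a) x z l) y *v d)"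
        by (simp only: hess)
    qed
  qed
  ultimately show ?thesis unfolding sosc_at_def by blast
qed

section \<open>Almost every perturbation\<close>

text \<open>Both uniform measures have Lebesgue densities, hence so does their product. Positive
  \<nu> gives the cube positive volume, from which the sigma-finiteness for
  \<open>pair_measure_density\<close> follows.\<close>

lemma AE_uniform_cube_pair:
  assumes "\<nu> > 0" and "AE p in (lborel :: (real^'m) measure) \<Otimes>\<^sub>M (lborel :: (real^'k) measure). P p"
  shows "AE p in (uniform_cube \<nu> :: (real^'m) measure) \<Otimes>\<^sub>M (uniform_cube \<nu> :: (real^'k) measure). P p"
proof -
  define f where "f = (\<lambda>x :: real^'m. indicator (cbox 0 (\<chi> i. \<nu>)) x / emeasure lborel (cbox 0 (\<chi> i. \<nu>) :: (real^'m) set) :: ennreal)"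
  define k where "k = (\<lambda>x :: real^'k. indicator (cbox 0 (\<chi> i. \<nu>)) x / emeasure lborel (cbox 0 (\<chi> i. \<nu>) :: (real^'k) set) :: ennreal)"
  have "emeasure lborel (cbox 0 (\<chi> i. \<nu>) :: (real^'k) set) \<noteq> 0"
  proof -
    have "box 0 (\<chi> i. \<nu>) \<noteq> ({} :: (real^'k) set)"
      using \<open>\<nu> > 0\<close> by (simp add: interval_ne_empty_cart)
    then show ?thesis
      using content_pos_lt_eq[of 0 "(\<chi> i. \<nu>) :: real^'k"] box_ne_empty(2)[of 0 "(\<chi> i. \<nu>) :: real^'k"]
      by (metis enn2real_0 less_irrefl measure_def measure_lborel_cbox_eq)
  qed
  then have "prob_space (uniform_measure lborel (cbox 0 (\<chi> i. \<nu>) :: (real^'k) set))"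
    by (intro prob_space_uniform_measure) (simp_all add: emeasure_lborel_cbox_eq)
  then have "sigma_finite_measure (density lborel k)"
    unfolding uniform_measure_def k_def
    by (intro finite_measure.axioms(1) prob_space.axioms(1))
  moreover have [measurable]: "f \<in> borel_measurable lborel" "k \<in> borel_measurable lborel"
    unfolding f_def k_def by measurable
  ultimately have "density lborel f \<Otimes>\<^sub>M density lborel k = density (lborel \<Otimes>\<^sub>M lborel) (\<lambda>(x, y). f x * k y)"
    by (intro pair_measure_density) (auto intro: lborel.sigma_finite_measure_axioms)
  moreover have "(uniform_cube \<nu> :: (real^'m) measure) = density lborel f"
    "(uniform_cube \<nu> :: (real^'k) measure) = density lborel k"
    by (simp_all add: uniform_cube_def uniform_measure_def f_def k_def)
  moreover have "AE p in density (lborel \<Otimes>\<^sub>M lborel) (\<lambda>(x, y). f x * k y). P p"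
    by (subst AE_density) (use assms(2) in \<open>auto elim: eventually_mono\<close>)
  ultimately show ?thesis by (simp only:)
qed

text \<open>\<open>E\<close> may fail to be Borel, as images under the KKT map are only known to be
  negligible; Fubini's theorem is applied to a Borel null superset.\<close>

lemma null_sections_if_negligible:
  fixes E :: "('a::euclidean_space \<times> 'b::euclidean_space) set"
  assumes "negligible E"
  shows "AE p in lborel. negligible {x. (p, x) \<in> E}"
proof -
  have "E \<in> null_sets (completion lborel)" by (rule assms[unfolded negligible_iff_null_sets])
  then obtain E' where E': "E' \<in> null_sets lborel" "E \<subseteq> E'"
    unfolding null_sets_completion_iff2 by blast
  have "AE q in lborel \<Otimes>\<^sub>M lborel. q \<notin> E'"
    unfolding lborel_prod by (rule AE_not_in[OF E'(1)])
  then have "AE p in lborel. AE x in lborel. (p, x) \<notin> E'"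
    by (rule lborel_pair.AE_pair)
  then show ?thesis
  proof eventually_elim
    case (elim p)
    have "{x. (p, x) \<in> E'} \<in> sets lborel"
    proof -
      have "E' \<in> sets (lborel \<Otimes>\<^sub>M lborel)" unfolding lborel_prod by (rule null_setsD2[OF E'(1)])
      from sets_Pair1[OF this, of p] show ?thesis by (simp add: vimage_def)
    qed
    then have "{x. (p, x) \<in> E'} \<in> null_sets lborel"
      using elim by (subst (asm) AE_iff_null) auto
    then have "negligible {x. (p, x) \<in> E'}"
      unfolding negligible_iff_null_sets by (rule null_sets_completionI)
    then show ?case by (rule negligible_subset) (use E' in blast)
  qed
qed

text \<open>Local minimizers come with arbitrary radii, but only countably many null sets can be
  united. Rational radii and centres in a countable dense set suffice.\<close>

lemma rational_cball_between:
  fixes D :: "'a::euclidean_space set"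
  assumes D: "\<And>S :: 'a set. open S \<Longrightarrow> S \<noteq> {} \<Longrightarrow> \<exists>d\<in>D. d \<in> S" and "e > 0"
  obtains q r where "q \<in> D" "r \<in> \<rat>" "y \<in> interior (cball q r)" "cball q r \<subseteq> ball y e"
proof -
  obtain r where r: "r \<in> \<rat>" "0 < r" "r < e / 2"
    using Rats_dense_in_real[of 0 "e / 2"] \<open>e > 0\<close> by auto
  obtain q where q: "q \<in> D" "q \<in> ball y r" using D[of "ball y r"] r by auto
  have "cball q r \<subseteq> ball y e"
  proof
    fix z assume "z \<in> cball q r"
    then have "dist y z < r + r" using q dist_triangle[of y z q] by (simp add: dist_commute)
    then show "z \<in> ball y e" using r by simp
  qed
  moreover have "y \<in> interior (cball q r)" using q by (simp add: dist_commute)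
  ultimately show thesis using that q r by blast
qed

theorem theorem3p3:
  fixes X :: "(real^'n) set"
    and U :: "((real^'n) \<times> (real^'m)) set"
    and g :: "(real^'n) \<times> (real^'m) \<Rightarrow> real"
    and h :: "'k::finite \<Rightarrow> (real^'n) \<times> (real^'m) \<Rightarrow> real"
    and \<rho> \<nu> :: real
  assumes "X \<in> sets lebesgue"
    and "open U" and "X \<times> UNIV \<subseteq> U"
    and "C_infinity_on g U" and "\<And>i. C_infinity_on (h i) U"
    and "\<rho> > 0"
    and "\<And>x. x \<in> X \<Longrightarrow> \<exists>y \<in> interior (feasible_set h x). \<forall>i. h i (x, y) \<le> - \<rho>"
    and "0 < \<nu>" and "\<nu> < \<rho>"
  shows "AE (b, a) in (uniform_cube \<nu> :: (real^'m) measure) \<Otimes>\<^sub>M (uniform_cube \<nu> :: (real^'k) measure).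
    {x \<in> X. \<exists>y. local_minimizer (perturbed_objective g b) (perturbed_constraint h a) x y \<and>
                \<not> sosc_at (perturbed_objective g b) (perturbed_constraint h a) x y}
      \<in> null_sets lebesgue"
proof -
  note g = assms(4) and h = assms(5)
  \<comment> \<open>The Borel part \<open>S\<close> is what the measurability of the sublevel sets
    requires; the remainder of \<open>X\<close> lies in the null set \<open>N'\<close>.\<close>
  obtain S N N' where X: "X = S \<union> N" "N \<subseteq> N'" "N' \<in> null_sets lborel" "S \<in> sets lborel"
    using sets_completionE[OF assms(1)] by metis
  have SU: "S \<times> UNIV \<subseteq> U" using assms(3) X(1) by blast
  have cont: "continuous_on (S \<times> UNIV) f" if "C_infinity_on f U" for f :: "(real^'n) \<times> (real^'m) \<Rightarrow> real"
    using SU by (intro continuous_at_imp_continuous_on ballI differentiable_imp_continuous_within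
        C_infinity_on_differentiable[OF that]) blast
  obtain D :: "(real^'m) set" where D: "countable D" "\<And>T. open T \<Longrightarrow> T \<noteq> {} \<Longrightarrow> \<exists>d\<in>D. d \<in> T"
    using countable_dense_exists by metis
  define E where "E = kkt_exceptional g h U \<union> (\<Union>q\<in>D. \<Union>r\<in>\<rat>. noncalm_params g h S (cball q r))"
  have "noncalm_params g h S (cball q r) \<in> null_sets lborel" for q r
    using X(4) by (intro null_noncalm_params cont g h compact_cball) simp
  then have "(\<Union>q\<in>D. \<Union>r\<in>\<rat>. noncalm_params g h S (cball q r)) \<in> null_sets lborel"
    by (intro null_sets_UN' D(1) countable_rat)
  then have "(\<Union>q\<in>D. \<Union>r\<in>\<rat>. noncalm_params g h S (cball q r)) \<in> null_sets lebesgue"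
    by (rule null_sets_completionI)
  then have "negligible E"
    unfolding E_def by (intro negligible_Un negligible_kkt_exceptional g h) (simp only: negligible_iff_null_sets)
  then have "AE p in lborel. negligible {x. (p, x) \<in> E}"
    by (rule null_sections_if_negligible)
  then have "AE p in (uniform_cube \<nu> :: (real^'m) measure) \<Otimes>\<^sub>M (uniform_cube \<nu> :: (real^'k) measure).
      negligible {x. (p, x) \<in> E}"
    by (intro AE_uniform_cube_pair assms) (simp only: lborel_prod)
  then show ?thesis
  proof (rule eventually_mono, clarify)
    fix b :: "real^'m" and a :: "real^'k"
    assume null: "negligible {x. ((b, a), x) \<in> E}"
    let ?G = "perturbed_objective g b" and ?H = "perturbed_constraint h a"
    have "{x \<in> X. \<exists>y. local_minimizer ?G ?H x y \<and> \<not> sosc_at ?G ?H x y} \<subseteq> {x. ((b, a), x) \<in> E} \<union> N'"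
    proof (rule subsetI, rule ccontr)
      fix x
      assume "x \<in> {x \<in> X. \<exists>y. local_minimizer ?G ?H x y \<and> \<not> sosc_at ?G ?H x y}"
        and notin: "x \<notin> {x. ((b, a), x) \<in> E} \<union> N'"
      then obtain y where "x \<in> X" and loc: "local_minimizer ?G ?H x y" and "\<not> sosc_at ?G ?H x y"
        by blast
      have "x \<in> S" using \<open>x \<in> X\<close> notin X by blast
      obtain e where "e > 0" and feas: "\<And>i. h i (x, y) + a $ i \<le> 0"
        and min: "\<And>z. z \<in> ball y e \<Longrightarrow> (\<And>i. h i (x, z) + a $ i \<le> 0) \<Longrightarrow> g (x, y) + y \<bullet> b \<le> g (x, z) + z \<bullet> b"
        using loc unfolding local_minimizer_def feasible_set_def perturbed_objective_def perturbed_constraint_def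
        by auto
      \<comment> \<open>On this ball from the countable family, \<open>y\<close> is a global
        minimizer among feasible points and also an interior point, as the calmness lemma
        demands.\<close>
      obtain q r where qr: "q \<in> D" "r \<in> \<rat>" "y \<in> interior (cball q r)" "cball q r \<subseteq> ball y e"
        using rational_cball_between[OF D(2) \<open>e > 0\<close>] by metis
      have "((b, a), x) \<notin> noncalm_params g h S (cball q r)"
        using notin qr unfolding E_def by blast
      then have "\<exists>M. calm_at (\<lambda>z. g (x, z) + z \<bullet> b) (\<lambda>i z. h i (x, z) + a $ i) y M"
      proof (rule calm_at_if_not_noncalm_params[where g=g and h=h, OF _ \<open>x \<in> S\<close> qr(3)])
        show "h i (x, y) + a $ i \<le> 0" for i by (rule feas)
        show "g (x, y) + y \<bullet> b \<le> g (x, z) + z \<bullet> b"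
          if "z \<in> cball q r" "\<And>i. h i (x, z) + a $ i \<le> 0" for z
          using min that qr(4) by blast
      qed
      then obtain M where "calm_at (\<lambda>z. g (x, z) + z \<bullet> b) (\<lambda>i z. h i (x, z) + a $ i) y M" ..
      then have "sosc_at ?G ?H x y"
        using SU \<open>x \<in> S\<close> notin feas unfolding E_def
        by (intro sosc_at_if_calm_and_not_exceptional[OF g h]) auto
      then show False using \<open>\<not> sosc_at ?G ?H x y\<close> by blast
    qed
    moreover have "negligible ({x. ((b, a), x) \<in> E} \<union> N')"
      using null null_sets_completionI[OF X(3)] by (simp add: negligible_iff_null_sets null_sets.Un)
    ultimately have "negligible {x \<in> X. \<exists>y. local_minimizer ?G ?H x y \<and> \<not> sosc_at ?G ?H x y}"
      by (rule negligible_subset[rotated])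
    then show "{x \<in> X. \<exists>y. local_minimizer ?G ?H x y \<and> \<not> sosc_at ?G ?H x y} \<in> null_sets lebesgue"
      by (simp only: negligible_iff_null_sets)
  qed
qed

end
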